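(* Let $X$ and $Y$ be compact metric spaces, and let $T$ be a map from $C(Y)$ to the space $B^b(X)$ of Borel functions on $X$ that are bounded above. Then the following assertions are equivalent: (1) $T$ is a backward Kantorovich operator from $C(Y)$ to $USC(X)$; that is, $Tg\in USC(X)$ for every $g\in C(Y)$, and $T$ is monotone increasing, translation invariant on constants, convex, and lower semi-continuous. (2) There exists a proper, convex, weak$^*$-lower semi-continuous function $\mathcal{T}:\mathcal{P}(X)\times\mathcal{P}(Y)\to\mathbb{R}\cup\{+\infty\}$ such that for all $\mu\in\mathcal{P}(X)$ and all $g\in C(Y)$, $$\mathcal{T}_\mu^*(g)=\int_X Tg\,d\mu ,$$ where $\mathcal{T}_\mu^*(g):=\sup\big\{\int_Y g\,d\nu-\mathcal{T}(\mu,\nu)\,;\ \nu\in\mathcal{P}(Y)\big\}$. (3) There exists a proper lower semi-continuous function $c:X\times\mathcal{P}(Y)\to\mathbb{R}\cup\{+\infty\}$ such that for every $x\in X$ the functional $\sigma\mapsto c(x,\sigma)$ is convex on $\mathcal{P}(Y)$, and for every $g\in C(Y)$ and every $x\in X$, $$Tg(x)=\sup\Big\{\int_Y g\,d\sigma-c(x,\sigma)\,;\ \sigma\in\mathcal{P}(Y)\Big\}.$$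
   Context: For a compact metric space $Z$, $C(Z)$ is the space of continuous real-valued functions on $Z$ with the uniform norm, and $\mathcal{P}(Z)$ is the set of Borel probability measures on $Z$ with the weak$^*$ topology (in duality with $C(Z)$). $USC(X)$ is the cone of functions $X\to\mathbb{R}\cup\{-\infty\}$ that are bounded above, proper (not identically $-\infty$) and upper semi-continuous. Functions in $B^b(X)$ are likewise allowed to take the value $-\infty$; integrals $\int_X Tg\,d\mu$ of such functions are well defined in $\mathbb{R}\cup\{-\infty\}$. A function with values in $\mathbb{R}\cup\{+\infty\}$ is proper if it is not identically $+\infty$. Convexity of $\mathcal{T}$ is joint convexity in $(\mu,\nu)$, its weak$^*$-lower semi-continuity is with respect to the product of the weak$^*$ topologies, and lower semi-continuity of $c$ is joint on $X\times\mathcal{P}(Y)$. A backward Kantorovich operator is a map $T:C(Y)\to USC(X)$ such that: - (monotone increasing) if $g_1,g_2\in C(Y)$ and $g_1\le g_2$, then $Tg_1\le Tg_2$; - (translation invariant on constants) if $k\in\mathbb{R}$ and $g\in C(Y)$, then $T(g+k)=Tg+k$; - (convex) if $\lambda\in[0,1]$ and $g_1,g_2\in C(Y)$, then $T(\lambda g_1+(1-\lambda)g_2)\le\lambda Tg_1+(1-\lambda)Tg_2$ pointwise on $X$ (with the convention $0\cdot(-\infty)=0$); - (lower semi-continuous) if $g_n\to g$ in $C(Y)$, then $Tg\le\liminf_{n\to\infty}Tg_n$ pointwise on $X$. The function $\mathcal{T}_\mu^*$ is the Legendre transform on $C(Y)$ of the functional $\mathcal{T}_\mu:\nu\mapsto\mathcal{T}(\mu,\nu)$,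 set equal to $+\infty$ outside $\mathcal{P}(Y)$. *)

theory Defs
  imports "HOL-Probability.Probability"
begin

text \<open>
  A compact metric space is a type \<open>'z::metric_space\<close> with \<open>compact (UNIV :: 'z set)\<close>.
  The space \<open>C(Z)\<close> is then the normed space \<open>'z \<Rightarrow>\<^sub>C real\<close> of bounded continuous functions:
  on a compact space the boundedness is automatic, and its norm is the uniform norm.
\<close>

subsection \<open>Borel probability measures with the weak* topology\<close>

definition borel_probs :: "'z::metric_space measure set" where
  "borel_probs = {\<mu>. prob_space \<mu> \<and> sets \<mu> = sets borel}"

text \<open>The coarsest topology on \<open>borel_probs\<close> making \<open>\<mu> \<mapsto> \<integral> g d\<mu>\<close> continuous for every \<open>g\<close>;
  \<open>euclidean\<close> is here the product topology on the functions \<open>('z \<Rightarrow>\<^sub>C real) \<Rightarrow> real\<close>.\<close>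

definition weakstar :: "'z::metric_space measure topology" where
  "weakstar = pullback_topology borel_probs
     (\<lambda>\<mu> (g :: 'z \<Rightarrow>\<^sub>C real). \<integral>z. apply_bcontfun g z \<partial>\<mu>) euclidean"

definition mix_measure :: "real \<Rightarrow> 'z::topological_space measure \<Rightarrow> 'z measure \<Rightarrow> 'z measure" where
  "mix_measure t \<mu> \<nu> = measure_of UNIV (sets borel)
     (\<lambda>A. ennreal t * emeasure \<mu> A + ennreal (1 - t) * emeasure \<nu> A)"

lemma sets_mix_measure [simp]: "sets (mix_measure t \<mu> \<nu>) = sets borel"
  unfolding mix_measure_def
  by (metis sets.sets_measure_of_eq space_borel)

lemma space_mix_measure [simp]: "space (mix_measure t \<mu> \<nu>) = UNIV"
  unfolding mix_measure_def by (simp add: space_measure_of_conv)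

text \<open>The set function in \<open>mix_measure_def\<close> is countably additive, so \<open>measure_of\<close>
  does not fall back to the zero measure.\<close>

lemma emeasure_mix_measure:
  assumes "sets \<mu> = sets borel" "sets \<nu> = sets borel" "A \<in> sets borel"
  shows "emeasure (mix_measure t \<mu> \<nu>) A =
    ennreal t * emeasure \<mu> A + ennreal (1 - t) * emeasure \<nu> A"
proof (rule emeasure_measure_of[OF mix_measure_def])
  show "sets borel \<subseteq> Pow (UNIV :: 'a set)" by simp
  show "A \<in> sets (mix_measure t \<mu> \<nu>)" using assms by simp
  show "positive (sets (mix_measure t \<mu> \<nu>))
      (\<lambda>A. ennreal t * emeasure \<mu> A + ennreal (1 - t) * emeasure \<nu> A)"
    by (simp add: positive_def)
  show "countably_additive (sets (mix_measure t \<mu> \<nu>))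
      (\<lambda>A. ennreal t * emeasure \<mu> A + ennreal (1 - t) * emeasure \<nu> A)"
  proof (rule countably_additiveI)
    fix B :: "nat \<Rightarrow> 'a set"
    assume B: "range B \<subseteq> sets (mix_measure t \<mu> \<nu>)" "disjoint_family B"
    have "(\<Sum>i. ennreal t * emeasure \<mu> (B i) + ennreal (1 - t) * emeasure \<nu> (B i))
        = ennreal t * (\<Sum>i. emeasure \<mu> (B i)) + ennreal (1 - t) * (\<Sum>i. emeasure \<nu> (B i))"
      by (simp add: suminf_add[symmetric])
    then show "(\<Sum>i. ennreal t * emeasure \<mu> (B i) + ennreal (1 - t) * emeasure \<nu> (B i)) =
        ennreal t * emeasure \<mu> (\<Union> (range B)) + ennreal (1 - t) * emeasure \<nu> (\<Union> (range B))"
      using B assms by (simp add: suminf_emeasure)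
  qed
qed

lemma mix_measure_in_borel_probs:
  assumes "\<mu> \<in> borel_probs" "\<nu> \<in> borel_probs" "0 \<le> t" "t \<le> 1"
  shows "mix_measure t \<mu> \<nu> \<in> borel_probs"
proof -
  have sets: "sets \<mu> = sets borel" "sets \<nu> = sets borel"
    and prob: "prob_space \<mu>" "prob_space \<nu>"
    using assms by (auto simp: borel_probs_def)
  have "emeasure \<mu> UNIV = 1" "emeasure \<nu> UNIV = 1"
    using prob_space.emeasure_space_1[OF prob(1)] prob_space.emeasure_space_1[OF prob(2)]
      sets_eq_imp_space_eq[OF sets(1)] sets_eq_imp_space_eq[OF sets(2)] by simp_all
  then have "emeasure (mix_measure t \<mu> \<nu>) UNIV = 1"
    using assms by (simp add: emeasure_mix_measure[OF sets] flip: ennreal_plus)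
  then show ?thesis
    by (auto simp: borel_probs_def intro!: prob_spaceI)
qed

subsection \<open>Extended-real-valued functions\<close>

definition lsc_map :: "'a topology \<Rightarrow> ('a \<Rightarrow> ereal) \<Rightarrow> bool" where
  "lsc_map X f \<longleftrightarrow> (\<forall>a. openin X {x \<in> topspace X. a < f x})"

definition usc_map :: "'a topology \<Rightarrow> ('a \<Rightarrow> ereal) \<Rightarrow> bool" where
  "usc_map X f \<longleftrightarrow> (\<forall>a. openin X {x \<in> topspace X. f x < a})"

text \<open>\<open>f\<close> takes values in \<open>\<real> \<union> {+\<infinity>}\<close> on \<open>S\<close> and is not identically \<open>+\<infinity>\<close> there.\<close>

definition proper_on :: "'a set \<Rightarrow> ('a \<Rightarrow> ereal) \<Rightarrow> bool" where
  "proper_on S f \<longleftrightarrow> (\<forall>x\<in>S. f x \<noteq> - \<infinity>) \<and> (\<exists>x\<in>S. f x \<noteq> \<infinity>)"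

text \<open>The bound excludes the value \<open>+\<infinity>\<close>, so these functions have values in \<open>\<real> \<union> {-\<infinity>}\<close>.\<close>

definition Bb :: "('x::metric_space \<Rightarrow> ereal) set" where
  "Bb = {f. f \<in> borel_measurable borel \<and> (\<exists>K::real. \<forall>x. f x \<le> ereal K)}"

definition USC :: "('x::metric_space \<Rightarrow> ereal) set" where
  "USC = {f. (\<exists>K::real. \<forall>x. f x \<le> ereal K) \<and> (\<exists>x. f x \<noteq> - \<infinity>) \<and> usc_map euclidean f}"

text \<open>Integral of the positive part minus integral of the negative part (\<open>e2ennreal\<close> maps
  negative numbers to 0). For \<open>f \<in> Bb\<close> and a probability measure the first term is finite.\<close>

definition ereal_integral :: "'x measure \<Rightarrow> ('x \<Rightarrow> ereal) \<Rightarrow> ereal" where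
  "ereal_integral \<mu> f =
     enn2ereal (\<integral>\<^sup>+x. e2ennreal (f x) \<partial>\<mu>) - enn2ereal (\<integral>\<^sup>+x. e2ennreal (- f x) \<partial>\<mu>)"

text \<open>In the next three definitions note that \<open>0 * \<infinity> = 0 * (- \<infinity>) = 0\<close> in type \<open>ereal\<close>.\<close>

definition convex_probs :: "('y::metric_space measure \<Rightarrow> ereal) \<Rightarrow> bool" where
  "convex_probs F \<longleftrightarrow>
     (\<forall>\<nu>\<^sub>1\<in>borel_probs. \<forall>\<nu>\<^sub>2\<in>borel_probs. \<forall>t\<in>{0..1}.
        F (mix_measure t \<nu>\<^sub>1 \<nu>\<^sub>2) \<le> ereal t * F \<nu>\<^sub>1 + ereal (1 - t) * F \<nu>\<^sub>2)"

definition jointly_convex_probs ::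
  "('x::metric_space measure \<Rightarrow> 'y::metric_space measure \<Rightarrow> ereal) \<Rightarrow> bool" where
  "jointly_convex_probs F \<longleftrightarrow>
     (\<forall>\<mu>\<^sub>1\<in>borel_probs. \<forall>\<mu>\<^sub>2\<in>borel_probs. \<forall>\<nu>\<^sub>1\<in>borel_probs. \<forall>\<nu>\<^sub>2\<in>borel_probs. \<forall>t\<in>{0..1}.
        F (mix_measure t \<mu>\<^sub>1 \<mu>\<^sub>2) (mix_measure t \<nu>\<^sub>1 \<nu>\<^sub>2)
          \<le> ereal t * F \<mu>\<^sub>1 \<nu>\<^sub>1 + ereal (1 - t) * F \<mu>\<^sub>2 \<nu>\<^sub>2)"

subsection \<open>Backward Kantorovich operators and the Legendre transform\<close>

definition backward_kantorovich ::
  "(('y::metric_space \<Rightarrow>\<^sub>C real) \<Rightarrow> 'x::metric_space \<Rightarrow> ereal) \<Rightarrow> bool" where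
  "backward_kantorovich T \<longleftrightarrow>
     (\<forall>g. T g \<in> USC) \<and>
     (\<forall>g\<^sub>1 g\<^sub>2. (\<forall>y. apply_bcontfun g\<^sub>1 y \<le> apply_bcontfun g\<^sub>2 y) \<longrightarrow> (\<forall>x. T g\<^sub>1 x \<le> T g\<^sub>2 x)) \<and>
     (\<forall>g k x. T (g + const_bcontfun k) x = T g x + ereal k) \<and>
     (\<forall>g\<^sub>1 g\<^sub>2. \<forall>t\<in>{0..1}. \<forall>x.
        T (t *\<^sub>R g\<^sub>1 + (1 - t) *\<^sub>R g\<^sub>2) x \<le> ereal t * T g\<^sub>1 x + ereal (1 - t) * T g\<^sub>2 x) \<and>
     (\<forall>gs g. gs \<longlonglongrightarrow> g \<longrightarrow> (\<forall>x. T g x \<le> liminf (\<lambda>n. T (gs n) x)))"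

text \<open>Legendre transform on \<open>C(Y)\<close> of \<open>F\<close> extended by \<open>+\<infinity>\<close> outside \<open>borel_probs\<close>.\<close>

definition legendre_probs ::
  "('y::metric_space measure \<Rightarrow> ereal) \<Rightarrow> ('y \<Rightarrow>\<^sub>C real) \<Rightarrow> ereal" where
  "legendre_probs F g = (SUP \<nu>\<in>borel_probs. ereal (\<integral>y. apply_bcontfun g y \<partial>\<nu>) - F \<nu>)"

end

theory Submission
  imports Defs
begin

text \<open>
  The implications run (1) to (2) to (3) to (1). Given a backward Kantorovich operator \<open>T\<close>, take for
  \<open>\<T> \<mu>\<close> the Legendre transform of \<open>p g = \<integral> T g d\<mu>\<close>, that is
  \<open>\<T> \<mu> \<nu> = sup\<^sub>g (\<integral> g d\<nu> - \<integral> T g d\<mu>)\<close>. It is lower semi-continuous because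
  \<open>\<mu> \<mapsto> \<integral> T g d\<mu>\<close> is upper semi-continuous. Where \<open>p\<close> is finite it is convex, monotone and translation
  invariant, so each of its subgradients, which exist by Hahn-Banach, is a normalised positive functional,
  hence a probability measure by the Riesz theorem, and attains the supremum in \<open>\<T>\<^sub>\<mu>\<^sup>* = p\<close>.
  For (3) restrict \<open>\<T>\<close> to Dirac masses. In the last step, upper semi-continuity of a supremum over
  probability measures comes from their weak* compactness.
\<close>

section \<open>A linear minorant of a convex function\<close>

text \<open>The value -\<infinity> of \<open>T g\<close> is the recurrent obstacle. Integrals are
  therefore handled through the nonnegative function \<open>K - f\<close>, for a real bound
  \<open>K\<close> of \<open>f\<close>. Monotonicity and translation invariance make \<integral>
  \<open>T g\<close> d\<mu> either finite for every \<open>g\<close> or -\<infinity> for every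
  \<open>g\<close>; the subgradient argument is needed only in the finite case. The increment of
  \<open>p\<close> at \<open>g\<close> is convex but in general not positively homogeneous, so
  Hahn-Banach is proved with a convex majorant vanishing at 0 instead of a sublinear one. Continuity
  of the resulting functional is never an issue, because positivity is all that the Riesz theorem
  uses. The Riesz theorem serves twice: it turns subgradients into measures, and it identifies the
  probability measures with a closed set of functionals, which gives weak* compactness. Properness
  needs an argument of its own when a cost is restricted to Dirac masses, since a cost may be finite
  at some pair without an evident reason to be finite at a Dirac mass.\<close>

text \<open>Nearly optimal indices at \<open>x\<close> and at \<open>y\<close> are merged into one
  index by \<open>dir\<close>, up to an arbitrary error. It serves for chains, where the merged
  index is the smaller function, and for a family jointly convex in index and point, where it is the
  convex combination of the indices.\<close>

lemma convex_on_INF_directed: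
  fixes F :: "'i \<Rightarrow> 'a::real_vector \<Rightarrow> real"
  assumes I: "I \<noteq> {}"
    and bdd: "\<And>x. bdd_below ((\<lambda>i. F i x) ` I)"
    and dir: "\<And>i j u w x y. i \<in> I \<Longrightarrow> j \<in> I \<Longrightarrow> 0 \<le> u \<Longrightarrow> 0 \<le> w \<Longrightarrow> u + w = 1 \<Longrightarrow>
      \<exists>k\<in>I. F k (u *\<^sub>R x + w *\<^sub>R y) \<le> u * F i x + w * F j y"
  shows "convex_on UNIV (\<lambda>x. INF i\<in>I. F i x)"
  unfolding convex_on_def
proof (intro conjI ballI allI impI convex_UNIV)
  fix x y :: 'a and u w :: real
  assume uw: "0 \<le> u" "0 \<le> w" "u + w = 1"
  let ?F = "\<lambda>x. INF i\<in>I. F i x"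
  show "?F (u *\<^sub>R x + w *\<^sub>R y) \<le> u * ?F x + w * ?F y"
  proof (rule field_le_epsilon)
    fix e :: real assume "0 < e"
    obtain i where i: "i \<in> I" "F i x < ?F x + e"
      using cINF_less_iff[OF I bdd, of x "?F x + e"] \<open>0 < e\<close> by auto
    obtain j where j: "j \<in> I" "F j y < ?F y + e"
      using cINF_less_iff[OF I bdd, of y "?F y + e"] \<open>0 < e\<close> by auto
    obtain k where k: "k \<in> I" "F k (u *\<^sub>R x + w *\<^sub>R y) \<le> u * F i x + w * F j y"
      using dir[OF i(1) j(1) uw] by blast
    have "?F (u *\<^sub>R x + w *\<^sub>R y) \<le> F k (u *\<^sub>R x + w *\<^sub>R y)"
      using cINF_lower[OF bdd k(1)] .
    also have "\<dots> \<le> u * F i x + w * F j y" by (fact k)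
    also have "\<dots> \<le> u * (?F x + e) + w * (?F y + e)"
      using i j uw by (intro add_mono mult_left_mono) auto
    also have "\<dots> = u * ?F x + w * ?F y + (u + w) * e" by (simp add: algebra_simps)
    finally show "?F (u *\<^sub>R x + w *\<^sub>R y) \<le> u * ?F x + w * ?F y + e" using uw by simp
  qed
qed

text \<open>Convexity at the midpoint 0 of \<open>x\<close> and \<open>-x\<close>. Combined with an
  upper bound \<open>p\<close> it bounds all competitors from below by \<open>- p (- x)\<close>, so
  that infima over chains are real.\<close>

lemma convex_on_ge_uminus:
  fixes q :: "'a::real_vector \<Rightarrow> real"
  assumes "convex_on UNIV q" "q 0 = 0"
  shows "- q (- x) \<le> q x"
  using convex_onD[OF assms(1), of "1/2" "x" "-x"] assms(2) by simp

text \<open>By Zorn there is a minimal convex function below \<open>p\<close> vanishing at 0. Minimality is tested first against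
  its rescalings \<open>x \<mapsto> q (s x) / s\<close>, which gives homogeneity, then against
  \<open>x \<mapsto> inf\<^sub>t (q (x + t v) - t q v)\<close>, which gives additivity.\<close>

theorem exists_linear_le_convex:
  fixes p :: "'a::real_vector \<Rightarrow> real"
  assumes p: "convex_on UNIV p" "p 0 = 0"
  obtains l where "linear l" "\<And>x. l x \<le> p x"
proof -
  define A where "A = {q. convex_on UNIV q \<and> q 0 = 0 \<and> (\<forall>x. q x \<le> p x)}"
  \<comment> \<open>The order is reversed, so that the maximal element supplied by Zorn is a minimal
    function and upper bounds of chains are pointwise infima.\<close>
  define P where "P = (\<lambda>a b :: 'a \<Rightarrow> real. b \<le> a)"
  have "\<exists>m\<in>A. \<forall>a\<in>A. P m a \<longrightarrow> a = m"
  proof (rule predicate_Zorn)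
    show "partial_order_on A (relation_of P A)"
      by (rule partial_order_on_relation_ofI) (auto simp: P_def)
    fix C assume C: "C \<in> Chains (relation_of P A)"
    then have CA: "C \<subseteq> A" and tot: "\<And>a b. a \<in> C \<Longrightarrow> b \<in> C \<Longrightarrow> a \<le> b \<or> b \<le> a"
      unfolding Chains_def relation_of_def P_def by auto
    show "\<exists>u\<in>A. \<forall>a\<in>C. P a u"
    proof (cases "C = {}")
      case True
      then show ?thesis using p by (auto simp: A_def)
    next
      case False
      have bdd: "bdd_below ((\<lambda>q. q x) ` C)" for x
      proof (rule bdd_belowI2)
        fix q assume "q \<in> C"
        then have q: "convex_on UNIV q" "q 0 = 0" "q (-x) \<le> p (-x)" using CA by (auto simp: A_def)
        then show "- p (- x) \<le> q x" using convex_on_ge_uminus[OF q(1,2), of x] by linarith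
      qed
      define v where "v x = (INF q\<in>C. q x)" for x
      have "convex_on UNIV v"
        unfolding v_def
      proof (rule convex_on_INF_directed[OF False bdd])
        fix i j :: "'a \<Rightarrow> real" and u w :: real and x y :: 'a
        assume h: "i \<in> C" "j \<in> C" "0 \<le> u" "0 \<le> w" "u + w = 1"
        then obtain k where k: "k \<in> C" "k \<le> i" "k \<le> j" using tot by blast
        then have "convex_on UNIV k" using CA by (auto simp: A_def)
        then have "k (u *\<^sub>R x + w *\<^sub>R y) \<le> u * k x + w * k y"
          using h unfolding convex_on_def by blast
        also have "\<dots> \<le> u * i x + w * j y"
          using h k by (intro add_mono mult_left_mono) (auto simp: le_fun_def)
        finally show "\<exists>k\<in>C. k (u *\<^sub>R x + w *\<^sub>R y) \<le> u * i x + w * j y" using k by blast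
      qed
      moreover have "v 0 = 0"
      proof -
        have "(\<lambda>q. q 0) ` C = {0}" using False CA by (force simp: A_def)
        then show ?thesis by (simp add: v_def)
      qed
      moreover have le: "v x \<le> q x" if "q \<in> C" for q x
        unfolding v_def using bdd that by (rule cINF_lower)
      moreover have "v x \<le> p x" for x
      proof -
        obtain q where "q \<in> C" using False by blast
        then have "q x \<le> p x" using CA by (auto simp: A_def)
        then show ?thesis using le[OF \<open>q \<in> C\<close>, of x] by linarith
      qed
      ultimately show ?thesis by (intro bexI[of _ v]) (auto simp: A_def P_def le_fun_def)
    qed
  qed
  then obtain q where q: "q \<in> A" and min: "\<And>a. a \<in> A \<Longrightarrow> a \<le> q \<Longrightarrow> a = q"
    by (auto simp: P_def)
  then have cq: "convex_on UNIV q" and q0: "q 0 = 0" and qp: "\<And>x. q x \<le> p x"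
    by (auto simp: A_def)
  have qcD: "q (u *\<^sub>R x + w *\<^sub>R y) \<le> u * q x + w * q y" if "0 \<le> u" "0 \<le> w" "u + w = 1" for u w x y
    using cq that unfolding convex_on_def by blast
  have scale1: "q (s *\<^sub>R x) = s * q x" if s: "0 < s" "s < 1" for s x
  proof -
    define r where "r x = q (s *\<^sub>R x) / s" for x
    have rq: "r x \<le> q x" for x
    proof -
      have "q (s *\<^sub>R x) \<le> s * q x" using qcD[of s "1 - s" x 0] s q0 by simp
      then show ?thesis using s by (simp add: r_def field_simps)
    qed
    have "convex_on UNIV r"
      unfolding convex_on_def
    proof (intro conjI ballI allI impI convex_UNIV)
      fix x y :: 'a and u w :: real
      assume uw: "0 \<le> u" "0 \<le> w" "u + w = 1"
      have "q (s *\<^sub>R (u *\<^sub>R x + w *\<^sub>R y)) = q (u *\<^sub>R (s *\<^sub>R x) + w *\<^sub>R (s *\<^sub>R y))"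
        by (simp add: scaleR_add_right mult.commute)
      also have "\<dots> \<le> u * q (s *\<^sub>R x) + w * q (s *\<^sub>R y)" using uw by (rule qcD)
      finally show "r (u *\<^sub>R x + w *\<^sub>R y) \<le> u * r x + w * r y"
        using s by (simp add: r_def field_simps)
    qed
    moreover have "r x \<le> p x" for x using rq[of x] qp[of x] by linarith
    ultimately have "r \<in> A" using q0 by (auto simp: A_def r_def)
    then have "r = q" using rq by (intro min) (auto simp: le_fun_def)
    then have "r x = q x" by simp
    then show ?thesis using s by (simp add: r_def field_simps)
  qed
  have scale: "q (t *\<^sub>R x) = t * q x" if t: "0 \<le> t" for t x
  proof -
    consider "t = 0" | "0 < t" "t < 1" | "t = 1" | "1 < t" using t by linarith
    then show ?thesis
    proof cases
      case 4
      then show ?thesis using scale1[of "1/t" "t *\<^sub>R x"] by (simp add: field_simps)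
    qed (use q0 scale1 in auto)
  qed
  have sub: "q (x + y) \<le> q x + q y" for x y
    using qcD[of "1/2" "1/2" x y] scale[of "1/2" "x + y"] by (simp add: scaleR_add_right)
  have super: "q x + q v \<le> q (x + v)" for x v
  proof -
    \<comment> \<open>The index \<open>t = 0\<close> puts the infimum below \<open>q\<close>; once
      minimality gives \<open>r = q\<close>, the index \<open>t = 1\<close> reads
      \<open>q x \<le> q (x + v) - q v\<close>.\<close>
    define F where "F t x = q (x + t *\<^sub>R v) - t * q v" for t x
    define r where "r x = (INF t\<in>{0..}. F t x)" for x
    have bdd: "bdd_below ((\<lambda>t. F t x) ` {0..})" for x
    proof (rule bdd_belowI2)
      fix t :: real assume "t \<in> {0..}"
      then show "- q (- x) \<le> F t x"
        using sub[of "x + t *\<^sub>R v" "- x"] scale[of t v] by (simp add: F_def)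
    qed
    have "convex_on UNIV r"
      unfolding r_def
    proof (rule convex_on_INF_directed[OF _ bdd])
      fix s t u w :: real and x y :: 'a
      assume h: "s \<in> {0..}" "t \<in> {0..}" "0 \<le> u" "0 \<le> w" "u + w = 1"
      have "u *\<^sub>R x + w *\<^sub>R y + (u * s + w * t) *\<^sub>R v = u *\<^sub>R (x + s *\<^sub>R v) + w *\<^sub>R (y + t *\<^sub>R v)"
        by (simp add: algebra_simps)
      then have "F (u * s + w * t) (u *\<^sub>R x + w *\<^sub>R y) \<le> u * F s x + w * F t y"
        using qcD[OF h(3-5), of "x + s *\<^sub>R v" "y + t *\<^sub>R v"] by (simp add: F_def algebra_simps)
      then show "\<exists>k\<in>{0..}. F k (u *\<^sub>R x + w *\<^sub>R y) \<le> u * F s x + w * F t y"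
        using h by (intro bexI[of _ "u * s + w * t"]) auto
    qed auto
    moreover have "r 0 = 0"
    proof -
      have "(\<lambda>t. F t 0) ` {0..} = {0}" using scale by (auto simp: F_def intro!: image_eqI[of _ _ 0] simp: q0)
      then show ?thesis by (simp add: r_def)
    qed
    moreover have rF: "r x \<le> F t x" if "0 \<le> t" for t x
      unfolding r_def using bdd that by (intro cINF_lower) auto
    have rq: "r x \<le> q x" for x using rF[of 0 x] by (simp add: F_def)
    moreover have "r x \<le> p x" for x using rq[of x] qp[of x] by linarith
    ultimately have "r \<in> A" by (auto simp: A_def)
    then have "r = q" using rq by (intro min) (auto simp: le_fun_def)
    then show ?thesis using rF[of 1 x] by (simp add: F_def)
  qed
  have add: "q (x + y) = q x + q y" for x y using sub super by (intro antisym)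
  have neg: "q (- x) = - q x" for x using add[of x "- x"] q0 by simp
  have "linear q"
  proof (rule linearI)
    fix c :: real and x
    show "q (c *\<^sub>R x) = c *\<^sub>R q x"
      using scale[of c x] scale[of "- c" x] neg[of "c *\<^sub>R x"] by (cases "0 \<le> c") auto
  qed (fact add)
  then show ?thesis using qp that by blast
qed

section \<open>The Riesz representation theorem on a compact metric space\<close>

text \<open>Normalised positive functionals on C(Z), stated on plain functions so that sums and
  products can be formed pointwise. The laws bind \<open>L\<close> at continuous arguments only; its
  other values are arbitrary.\<close>

locale positive_functional =
  fixes L :: "('a::metric_space \<Rightarrow> real) \<Rightarrow> real"
  assumes compact_space: "compact (UNIV :: 'a set)"
    and add: "continuous_on UNIV f \<Longrightarrow> continuous_on UNIV g \<Longrightarrow> L (\<lambda>x. f x + g x) = L f + L g"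
    and scale: "continuous_on UNIV f \<Longrightarrow> L (\<lambda>x. c * f x) = c * L f"
    and nonneg: "continuous_on UNIV f \<Longrightarrow> (\<And>x. 0 \<le> f x) \<Longrightarrow> 0 \<le> L f"
    and one: "L (\<lambda>x. 1) = 1"
begin

lemma diff:
  assumes "continuous_on UNIV f" "continuous_on UNIV g"
  shows "L (\<lambda>x. f x - g x) = L f - L g"
  using add[of f "\<lambda>x. - 1 * g x"] scale[of g "-1"] assms by (simp add: continuous_on_minus)

lemma const: "L (\<lambda>x. c) = c"
  using scale[of "\<lambda>x. 1" c] one by simp

lemma mono:
  assumes "continuous_on UNIV f" "continuous_on UNIV g" "\<And>x. f x \<le> g x"
  shows "L f \<le> L g"
  using nonneg[of "\<lambda>x. g x - f x"] diff[of g f] assms by (simp add: continuous_on_diff)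

lemma sum:
  assumes "\<And>i. i \<in> I \<Longrightarrow> continuous_on UNIV (f i)"
  shows "L (\<lambda>x. \<Sum>i\<in>I. f i x) = (\<Sum>i\<in>I. L (f i))"
  using assms by (induction I rule: infinite_finite_induct) (simp_all add: const add continuous_on_sum)

section \<open>Caratheodory construction of the representing measure\<close>

text \<open>Such a sequence stands for its supremum, a lower semi-continuous majorant of the
  indicator of \<open>A\<close>. The value 1 has to be reached at a finite index, not just in the
  limit.\<close>

definition covers :: "'a set \<Rightarrow> (nat \<Rightarrow> 'a \<Rightarrow> real) \<Rightarrow> bool" where
  "covers A F \<longleftrightarrow> (\<forall>n. continuous_on UNIV (F n)) \<and> (\<forall>n x. 0 \<le> F n x) \<and> (\<forall>x. incseq (\<lambda>n. F n x))
     \<and> (\<forall>x\<in>A. \<exists>n. 1 \<le> F n x)"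

text \<open>Using increasing sequences instead of open sets makes \<open>outer\<close> countably subadditive by summing the
  sequences, and makes closed sets measurable by multiplying the sequences with continuous
  functions increasing to the indicator of the complement.\<close>

definition outer :: "'a set \<Rightarrow> ennreal" where
  "outer A = (INF F\<in>{F. covers A F}. SUP n. ennreal (L (F n)))"

lemma outer_le: "covers A F \<Longrightarrow> outer A \<le> (SUP n. ennreal (L (F n)))"
  unfolding outer_def by (rule INF_lower) simp

lemma outer_le_const:
  assumes "continuous_on UNIV f" "\<And>x. 0 \<le> f x" "\<And>x. x \<in> A \<Longrightarrow> 1 \<le> f x"
  shows "outer A \<le> ennreal (L f)"
  using outer_le[of A "\<lambda>n. f"] assms by (simp add: covers_def incseq_def)

lemma outer_mono: "A \<subseteq> B \<Longrightarrow> outer A \<le> outer B"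
  unfolding outer_def covers_def by (intro INF_superset_mono) auto

lemma outer_empty: "outer {} = 0"
  using outer_le_const[of "\<lambda>x. 0" "{}"] by (simp add: const)

text \<open>The constant 1 gives the upper bound. The lower bound is a Dini argument: the sets where
  \<open>F n\<close> exceeds \<open>1 - e\<close> are open and cover the compact space, so by
  monotonicity a single \<open>F n\<close> is at least \<open>1 - e\<close> everywhere.\<close>

lemma outer_UNIV: "outer UNIV = 1"
proof (rule antisym)
  show "outer UNIV \<le> 1" using outer_le_const[of "\<lambda>x. 1" UNIV] by (simp add: one)
  show "1 \<le> outer UNIV"
    unfolding outer_def
  proof (rule INF_greatest)
    fix F assume "F \<in> {F. covers UNIV F}"
    then have F: "\<And>n. continuous_on UNIV (F n)" "\<And>n x. 0 \<le> F n x" "\<And>x. incseq (\<lambda>n. F n x)"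
      "\<And>x. \<exists>n. 1 \<le> F n x" by (auto simp: covers_def)
    have "ennreal (1 - e) \<le> (SUP n. ennreal (L (F n)))" if e: "0 < e" for e
    proof -
      have "open {x. 1 - e < F n x}" for n
        using F(1)[of n] by (intro open_Collect_less) auto
      moreover have "UNIV \<subseteq> (\<Union>n. {x. 1 - e < F n x})"
      proof
        fix x
        obtain n where "1 \<le> F n x" using F(4) by blast
        then show "x \<in> (\<Union>n. {x. 1 - e < F n x})" using e by (auto intro!: exI[of _ n])
      qed
      ultimately obtain N where N: "finite N" "UNIV \<subseteq> (\<Union>n\<in>N. {x. 1 - e < F n x})"
        by (rule compactE_image[OF compact_space])
      have "1 - e \<le> F (Max N) x" for x
      proof -
        obtain n where n: "n \<in> N" "1 - e < F n x" using N(2) by auto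
        then have "F n x \<le> F (Max N) x" using N(1) incseqD[OF F(3)[of x], of n "Max N"] by simp
        then show ?thesis using n by simp
      qed
      then have "1 - e \<le> L (F (Max N))" using mono[of "\<lambda>x. 1 - e" "F (Max N)"] F(1) by (simp add: const)
      then have "ennreal (1 - e) \<le> ennreal (L (F (Max N)))" by (rule ennreal_leI)
      also have "\<dots> \<le> (SUP n. ennreal (L (F n)))" by (rule SUP_upper) simp
      finally show ?thesis .
    qed
    then have le: "ennreal (1 - inverse (real (Suc n))) \<le> (SUP n. ennreal (L (F n)))" for n by simp
    have "(\<lambda>n. 1 - inverse (real (Suc n))) \<longlonglongrightarrow> 1 - 0"
      by (intro tendsto_intros LIMSEQ_inverse_real_of_nat)
    then have "(\<lambda>n. ennreal (1 - inverse (real (Suc n)))) \<longlonglongrightarrow> ennreal 1"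
      by (intro tendsto_ennrealI) simp
    then show "1 \<le> (SUP n. ennreal (L (F n)))"
      using le by (intro LIMSEQ_le_const2[where X="\<lambda>n. ennreal (1 - inverse (real (Suc n)))" and x=1]) auto
  qed
qed

lemma outer_approx:
  assumes "outer A < c"
  obtains F where "covers A F" "(SUP n. ennreal (L (F n))) < c"
  using assms unfolding outer_def by (auto simp: INF_less_iff)

text \<open>Covers that are optimal up to \<open>e / 2^(i+1)\<close> are added; the errors sum to
  \<open>e\<close>. Only a finite right-hand side has to be considered, which is what allows a
  strict gap above each \<open>outer (A i)\<close>.\<close>

lemma outer_UN: "outer (\<Union>i. A i) \<le> (\<Sum>i. outer (A i))"
proof (rule ennreal_le_epsilon)
  fix e :: real assume e: "0 < e" and fin: "(\<Sum>i. outer (A i)) < top"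
  have "\<exists>F. covers (A i) F \<and> (SUP n. ennreal (L (F n))) \<le> outer (A i) + ennreal (e * (1/2)^Suc i)" for i
  proof -
    have "outer (A i) \<le> (\<Sum>i. outer (A i))" using sum_le_suminf[of "\<lambda>i. outer (A i)" "{i}"] by simp
    then have "outer (A i) < top" using fin by (rule le_less_trans)
    then have "outer (A i) < outer (A i) + ennreal (e * (1/2)^Suc i)"
      using e by (cases "outer (A i)") (auto simp: ennreal_less_iff simp flip: ennreal_plus)
    then obtain F where "covers (A i) F" "(SUP n. ennreal (L (F n))) < outer (A i) + ennreal (e * (1/2)^Suc i)"
      by (rule outer_approx)
    then show ?thesis by (auto intro!: less_imp_le)
  qed
  then obtain F where F: "\<And>i. covers (A i) (F i)"
    and le: "\<And>i. (SUP n. ennreal (L (F i n))) \<le> outer (A i) + ennreal (e * (1/2)^Suc i)" by metis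
  have Fc: "\<And>i n. continuous_on UNIV (F i n)" "\<And>i n x. 0 \<le> F i n x" "\<And>i x. incseq (\<lambda>n. F i n x)"
    "\<And>i x. x \<in> A i \<Longrightarrow> \<exists>n. 1 \<le> F i n x" using F by (auto simp: covers_def)
  \<comment> \<open>Diagonal choice: the same \<open>n\<close> bounds the number of summands and
    indexes the sequences, so each \<open>G n\<close> is a finite sum and stays continuous.\<close>
  define G where "G n x = (\<Sum>i\<le>n. F i n x)" for n x
  have Gc: "continuous_on UNIV (G n)" for n unfolding G_def by (intro continuous_on_sum Fc)
  have "covers (\<Union>i. A i) G"
    unfolding covers_def
  proof (intro conjI allI ballI)
    show "continuous_on UNIV (G n)" for n by (rule Gc)
    show "0 \<le> G n x" for n x unfolding G_def by (intro sum_nonneg Fc)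
    show "incseq (\<lambda>n. G n x)" for x
    proof (rule incseq_SucI)
      fix n
      have "(\<Sum>i\<le>n. F i n x) \<le> (\<Sum>i\<le>n. F i (Suc n) x)" by (intro sum_mono incseq_SucD[OF Fc(3)])
      also have "\<dots> \<le> (\<Sum>i\<le>Suc n. F i (Suc n) x)" using Fc(2) by simp
      finally show "G n x \<le> G (Suc n) x" by (simp add: G_def)
    qed
    fix x assume "x \<in> (\<Union>i. A i)"
    then obtain i n where n: "1 \<le> F i n x" using Fc(4) by blast
    \<comment> \<open>The index \<open>max i n\<close> is late enough for the value 1 to be reached
      and for the summand \<open>i\<close> to be present.\<close>
    have "F i n x \<le> F i (max i n) x" using Fc(3)[of i x] by (auto intro: incseqD)
    also have "\<dots> \<le> G (max i n) x"
      unfolding G_def using Fc(2) by (intro member_le_sum) auto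
    finally show "\<exists>n. 1 \<le> G n x" using n by (auto intro: order_trans)
  qed
  then have "outer (\<Union>i. A i) \<le> (SUP n. ennreal (L (G n)))" by (rule outer_le)
  also have "\<dots> \<le> (\<Sum>i. outer (A i) + ennreal (e * (1/2)^Suc i))"
  proof (rule SUP_least)
    fix n
    have "ennreal (L (G n)) = (\<Sum>i\<le>n. ennreal (L (F i n)))"
      unfolding G_def by (subst sum) (auto simp: Fc sum_ennreal nonneg)
    also have "\<dots> \<le> (\<Sum>i\<le>n. outer (A i) + ennreal (e * (1/2)^Suc i))"
      by (intro sum_mono order_trans[OF _ le] SUP_upper) auto
    also have "\<dots> \<le> (\<Sum>i. outer (A i) + ennreal (e * (1/2)^Suc i))"
      by (rule sum_le_suminf) auto
    finally show "ennreal (L (G n)) \<le> (\<Sum>i. outer (A i) + ennreal (e * (1/2)^Suc i))" .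
  qed
  also have "\<dots> = (\<Sum>i. outer (A i)) + (\<Sum>i. ennreal (e * (1/2)^Suc i))"
    by (rule suminf_add[symmetric]) auto
  also have "(\<Sum>i. ennreal (e * (1/2)^Suc i)) = ennreal e"
    using sums_mult[OF power_half_series, of e] e by (intro suminf_ennreal_eq) auto
  finally show "outer (\<Union>i. A i) \<le> (\<Sum>i. outer (A i)) + ennreal e" .
qed

lemma outer_measure_space_outer: "outer_measure_space UNIV outer"
  unfolding outer_measure_space_def positive_def increasing_def countably_subadditive_def
  by (auto simp: outer_empty outer_UN intro: outer_mono)

lemma outer_subadd:
  assumes "A \<inter> B = {}"
  shows "outer (A \<union> B) \<le> outer A + outer B"
proof -
  interpret sigma_algebra UNIV "UNIV :: 'a set set" using sigma_algebra_Pow[of UNIV] by simp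
  have "subadditive UNIV outer"
    using outer_measure_space_outer
    by (auto simp: outer_measure_space_def intro!: countably_subadditive_subadditive)
  then show ?thesis using assms by (simp add: subadditive_def)
qed

text \<open>The functions \<open>g k\<close> increase to the indicator of the complement of
  \<open>C\<close>. A cover \<open>F\<close> of \<open>A\<close> splits into
  \<open>F n * g n\<close>, covering \<open>A - C\<close>, and \<open>F n * (1 - g k)\<close>,
  covering \<open>A \<inter> C\<close>. The two parts recombine because
  \<open>F n * (1 - g k) + F k * g k\<close> is a convex combination bounded by
  \<open>F (max n k)\<close>.\<close>

lemma closed_in_lambda_system:
  assumes C: "closed C"
  shows "C \<in> lambda_system UNIV UNIV outer"
proof -
  have key: "outer (A - C) + outer (A \<inter> C) \<le> outer A" for A
  \<comment> \<open>By convention \<open>infdist\<close> to the empty set is 0, so the functions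
    \<open>g k\<close> would vanish instead of tending to 1.\<close>
  proof (cases "C = {}")
    case True
    then show ?thesis by (simp add: outer_empty)
  next
    case False
    show ?thesis
      unfolding outer_def[of A]
    proof (rule INF_greatest)
      fix F assume "F \<in> {F. covers A F}"
      then have F: "\<And>n. continuous_on UNIV (F n)" "\<And>n x. 0 \<le> F n x" "\<And>x. incseq (\<lambda>n. F n x)"
        "\<And>x. x \<in> A \<Longrightarrow> \<exists>n. 1 \<le> F n x" by (auto simp: covers_def)
      define g where "g k x = min 1 (real k * infdist x C)" for k x
      have g: "continuous_on UNIV (g k)" "0 \<le> g k x" "g k x \<le> 1" for k x
        unfolding g_def by (auto intro!: continuous_intros simp: infdist_nonneg)
      have ginc: "g k x \<le> g l x" if "k \<le> l" for k l x
        using that unfolding g_def by (intro min.mono mult_right_mono) (auto simp: infdist_nonneg)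
      let ?S = "SUP n. ennreal (L (F n))"
      have cov1: "covers (A - C) (\<lambda>n x. F n x * g n x)"
        unfolding covers_def
      proof (intro conjI allI ballI)
        show "continuous_on UNIV (\<lambda>x. F n x * g n x)" for n by (intro continuous_on_mult F g)
        show "0 \<le> F n x * g n x" for n x using F g by simp
        show "incseq (\<lambda>n. F n x * g n x)" for x
        proof (rule incseq_SucI)
          fix n
          have "F n x \<le> F (Suc n) x" using F(3)[of x] by (rule incseq_SucD)
          then show "F n x * g n x \<le> F (Suc n) x * g (Suc n) x"
            by (intro mult_mono ginc F g) auto
        qed
        fix x assume x: "x \<in> A - C"
        obtain n where n: "1 \<le> F n x" using F(4) x by blast
        have "0 < infdist x C" using x C False by (intro infdist_pos_not_in_closed) auto
        then obtain m where m: "1 < real m * infdist x C" using reals_Archimedean3 by blast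
        have "1 \<le> F (max n m) x" using n F(3)[of x] by (meson incseqD max.cobounded1 order_trans)
        moreover have "g (max n m) x = 1"
          using ginc[of m "max n m" x] g(3)[of "max n m" x] m by (simp add: g_def)
        ultimately show "\<exists>n. 1 \<le> F n x * g n x" by (intro exI[of _ "max n m"]) simp
      qed
      \<comment> \<open>Here \<open>k\<close> stays fixed: \<open>1 - g k\<close> decreases in
        \<open>k\<close>, so the diagonal sequence need not be increasing. The supremum over
        \<open>k\<close> is taken at the very end.\<close>
      have cov2: "covers (A \<inter> C) (\<lambda>n x. F n x * (1 - g k x))" for k
        unfolding covers_def
      proof (intro conjI allI ballI)
        show "continuous_on UNIV (\<lambda>x. F n x * (1 - g k x))" for n by (intro continuous_intros F g)
        show "0 \<le> F n x * (1 - g k x)" for n x using F g by simp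
        show "incseq (\<lambda>n. F n x * (1 - g k x))" for x
        proof (rule incseq_SucI)
          fix n
          have "F n x \<le> F (Suc n) x" using F(3)[of x] by (rule incseq_SucD)
          then show "F n x * (1 - g k x) \<le> F (Suc n) x * (1 - g k x)"
            using g(3)[of k x] by (intro mult_right_mono) auto
        qed
        fix x assume "x \<in> A \<inter> C"
        then show "\<exists>n. 1 \<le> F n x * (1 - g k x)" using F(4)[of x] by (auto simp: g_def)
      qed
      have "outer (A \<inter> C) + ennreal (L (\<lambda>x. F k x * g k x)) \<le> ?S" for k
      proof -
        have "outer (A \<inter> C) \<le> (SUP n. ennreal (L (\<lambda>x. F n x * (1 - g k x))))"
          by (rule outer_le[OF cov2])
        then have "outer (A \<inter> C) + ennreal (L (\<lambda>x. F k x * g k x)) \<le>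
          (SUP n. ennreal (L (\<lambda>x. F n x * (1 - g k x)))) + ennreal (L (\<lambda>x. F k x * g k x))"
          by (rule add_right_mono)
        also have "\<dots> = (SUP n. ennreal (L (\<lambda>x. F n x * (1 - g k x))) + ennreal (L (\<lambda>x. F k x * g k x)))"
          by (rule ennreal_SUP_add_left[symmetric]) auto
        also have "\<dots> \<le> ?S"
        proof (rule SUP_least)
          fix n
          let ?m = "max n k"
          have c: "continuous_on UNIV (\<lambda>x. F n x * (1 - g k x))" "continuous_on UNIV (\<lambda>x. F k x * g k x)" for n k
            by (intro continuous_intros F g)+
          have "ennreal (L (\<lambda>x. F n x * (1 - g k x))) + ennreal (L (\<lambda>x. F k x * g k x)) =
            ennreal (L (\<lambda>x. F n x * (1 - g k x)) + L (\<lambda>x. F k x * g k x))"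
            using c F g by (intro ennreal_plus[symmetric] nonneg) auto
          also have "L (\<lambda>x. F n x * (1 - g k x)) + L (\<lambda>x. F k x * g k x) =
            L (\<lambda>x. F n x * (1 - g k x) + F k x * g k x)" by (rule add[symmetric]) (rule c)+
          also have "\<dots> \<le> L (F ?m)"
          proof (rule mono)
            show "continuous_on UNIV (\<lambda>x. F n x * (1 - g k x) + F k x * g k x)"
              by (intro continuous_intros F g)
            fix x
            have "F n x * (1 - g k x) + F k x * g k x \<le> F ?m x * (1 - g k x) + F ?m x * g k x"
              using g(2,3)[of k x] by (intro add_mono mult_right_mono incseqD[OF F(3)]) auto
            then show "F n x * (1 - g k x) + F k x * g k x \<le> F ?m x" by (simp add: algebra_simps)
          qed (rule F)
          finally show "ennreal (L (\<lambda>x. F n x * (1 - g k x))) + ennreal (L (\<lambda>x. F k x * g k x)) \<le> ?S"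
            by (meson SUP_upper2 UNIV_I ennreal_leI)
        qed
        finally show ?thesis .
      qed
      then have "(SUP k. outer (A \<inter> C) + ennreal (L (\<lambda>x. F k x * g k x))) \<le> ?S" by (rule SUP_least)
      also have "(SUP k. outer (A \<inter> C) + ennreal (L (\<lambda>x. F k x * g k x))) =
        outer (A \<inter> C) + (SUP k. ennreal (L (\<lambda>x. F k x * g k x)))"
        by (rule ennreal_SUP_add_right[symmetric]) auto
      finally have le: "outer (A \<inter> C) + (SUP k. ennreal (L (\<lambda>x. F k x * g k x))) \<le> ?S" .
      have "outer (A - C) + outer (A \<inter> C) \<le> (SUP k. ennreal (L (\<lambda>x. F k x * g k x))) + outer (A \<inter> C)"
        by (intro add_right_mono outer_le cov1)
      also have "\<dots> = outer (A \<inter> C) + (SUP k. ennreal (L (\<lambda>x. F k x * g k x)))"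
        by (rule add.commute)
      also note le
      finally show "outer (A - C) + outer (A \<inter> C) \<le> ?S" .
    qed
  qed
  have "outer (C \<inter> A) + outer ((UNIV - C) \<inter> A) = outer A" for A
  proof (rule antisym)
    show "outer (C \<inter> A) + outer ((UNIV - C) \<inter> A) \<le> outer A"
      using key[of A] by (simp add: Int_commute Diff_eq add.commute)
    have "outer ((C \<inter> A) \<union> ((UNIV - C) \<inter> A)) \<le> outer (C \<inter> A) + outer ((UNIV - C) \<inter> A)"
      by (rule outer_subadd) auto
    then show "outer A \<le> outer (C \<inter> A) + outer ((UNIV - C) \<inter> A)"
      by (simp add: Int_Un_distrib2[symmetric])
  qed
  then show ?thesis by (simp add: lambda_system_def)
qed

definition rep_measure :: "'a measure" where
  "rep_measure = measure_of UNIV (sets borel) outer"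

lemma sets_rep_measure [simp]: "sets rep_measure = sets borel"
  unfolding rep_measure_def by (metis sets.sets_measure_of_eq space_borel)

lemma space_rep_measure [simp]: "space rep_measure = UNIV"
  unfolding rep_measure_def by (simp add: space_measure_of_conv)

text \<open>By Caratheodory \<open>outer\<close> is a measure on its lambda system, a sigma-algebra
  that contains the closed sets and hence all Borel sets. This rules out the zero measure as the
  fallback of \<open>measure_of\<close>.\<close>

lemma emeasure_rep_measure:
  assumes "A \<in> sets borel"
  shows "emeasure rep_measure A = outer A"
proof -
  have ms: "measure_space UNIV (lambda_system UNIV UNIV outer) outer"
    using sigma_algebra.caratheodory_lemma[OF sigma_algebra_Pow[of UNIV, unfolded Pow_UNIV] outer_measure_space_outer] .
  then have "sigma_algebra UNIV (lambda_system UNIV UNIV outer)"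
    by (simp add: measure_space_def)
  then have "sigma_sets UNIV (Collect closed) \<subseteq> lambda_system UNIV UNIV outer"
    using closed_in_lambda_system by (intro sigma_algebra.sigma_sets_subset) auto
  then have sub: "sets borel \<subseteq> lambda_system UNIV UNIV outer"
    by (simp add: borel_eq_closed)
  show ?thesis
  proof (rule emeasure_measure_of[OF rep_measure_def])
    show "positive (sets rep_measure) outer" by (simp add: positive_def outer_empty)
    show "countably_additive (sets rep_measure) outer"
    proof (rule countably_additiveI)
      fix A :: "nat \<Rightarrow> 'a set"
      assume A: "range A \<subseteq> sets rep_measure" "disjoint_family A" "(\<Union>i. A i) \<in> sets rep_measure"
      have "range A \<subseteq> lambda_system UNIV UNIV outer" "(\<Union>i. A i) \<in> lambda_system UNIV UNIV outer"
        using A(1,3) sub unfolding sets_rep_measure by (auto dest: subsetD)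
      then show "(\<Sum>i. outer (A i)) = outer (\<Union>i. A i)"
        using ms A(2) by (simp add: measure_space_def countably_additive_def)
    qed
  qed (use assms in auto)
qed

lemma prob_space_rep_measure: "prob_space rep_measure"
  by (rule prob_spaceI) (simp add: emeasure_rep_measure outer_UNIV)

section \<open>Integration against the representing measure\<close>

text \<open>The summand \<open>i\<close> is the length of the part of \<open>[0, x]\<close> inside
  \<open>[i, i + 1]\<close>.\<close>

lemma sum_clamp:
  fixes x :: real assumes "0 \<le> x"
  shows "(\<Sum>i<n. max 0 (min 1 (x - real i))) = min x (real n)"
proof (induction n)
  case (Suc n)
  then show ?case by (cases "x \<le> real n"; cases "x \<le> real n + 1") (simp_all add: max_def min_def)
qed (use assms in simp)

lemma bounded_integrable_rep:
  assumes f: "continuous_on UNIV f" shows "integrable rep_measure (f :: 'a \<Rightarrow> real)"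
proof -
  interpret prob_space rep_measure by (rule prob_space_rep_measure)
  have "bounded (range f)" using compact_continuous_image[OF f compact_space] by (rule compact_imp_bounded)
  then obtain B where "\<And>x. norm (f x) \<le> B" by (auto simp: bounded_iff)
  moreover have "f \<in> borel_measurable rep_measure"
    using f by (simp add: borel_measurable_continuous_onI cong: measurable_cong_sets)
  ultimately show ?thesis by (intro integrable_const_bound[where B=B]) auto
qed

text \<open>Layer cake: \<open>n f\<close> is the sum of the clamped layers \<open>h i\<close>, and \<open>h i\<close> dominates the indicator
  of the super-level set \<open>A (i + 1)\<close>. The remaining level \<open>A 0\<close> costs at most \<open>1 / n\<close>.\<close>

lemma integral_rep_le:
  assumes f: "continuous_on UNIV f" "\<And>x. 0 \<le> f x" "\<And>x. f x \<le> 1"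
  shows "(\<integral>x. f x \<partial>rep_measure) \<le> L f"
proof -
  interpret prob_space rep_measure by (rule prob_space_rep_measure)
  have le: "(\<integral>x. f x \<partial>rep_measure) \<le> L f + inverse (real (Suc N))" for N
  proof -
    define n where "n = Suc N"
    have n: "0 < n" by (simp add: n_def)
    define h where "h i x = max 0 (min 1 (real n * f x - real i))" for i x
    define A where "A i = {x. real i < real n * f x}" for i
    have hc: "continuous_on UNIV (h i)" for i unfolding h_def by (intro continuous_intros f)
    have A: "A i \<in> sets borel" for i
      unfolding A_def using f(1) by (intro borel_open open_Collect_less continuous_intros) 
    have pt: "real n * f x \<le> (\<Sum>i<n. indicator (A i) x)" for x
    proof -
      have "(\<Sum>i<n. indicator (A i) x :: real) \<ge> (\<Sum>i<n. h i x)"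
        by (intro sum_mono) (auto simp: h_def A_def indicator_def)
      moreover have "(\<Sum>i<n. h i x) = real n * f x"
        unfolding h_def using f by (subst sum_clamp) (auto simp: min_def mult_left_le)
      ultimately show ?thesis by simp
    qed
    have "real n * (\<integral>x. f x \<partial>rep_measure) = (\<integral>x. real n * f x \<partial>rep_measure)" by simp
    also have "\<dots> \<le> (\<integral>x. (\<Sum>i<n. indicator (A i) x) \<partial>rep_measure)"
    proof (rule integral_mono[OF _ _ pt])
      show "integrable rep_measure (\<lambda>x. real n * f x)"
        using bounded_integrable_rep[OF f(1)] by simp
      show "integrable rep_measure (\<lambda>x. \<Sum>i<n. indicator (A i) x :: real)"
        using A by (intro Bochner_Integration.integrable_sum)
          (auto intro!: integrable_real_indicator simp: emeasure_eq_measure)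
    qed
    also have "\<dots> = (\<Sum>i<n. measure rep_measure (A i))"
      using A by (subst Bochner_Integration.integral_sum) (auto intro!: integrable_real_indicator simp: emeasure_eq_measure)
    also have "\<dots> = measure rep_measure (A 0) + (\<Sum>i<N. measure rep_measure (A (Suc i)))"
      unfolding n_def by (rule sum.lessThan_Suc_shift)
    also have "\<dots> \<le> 1 + (\<Sum>i<N. L (h i))"
    proof (intro add_mono sum_mono prob_le_1)
      fix i
      have "outer (A (Suc i)) \<le> ennreal (L (h i))"
        by (rule outer_le_const[OF hc]) (auto simp: h_def A_def)
      then show "measure rep_measure (A (Suc i)) \<le> L (h i)"
        using A hc by (simp add: emeasure_rep_measure[symmetric] emeasure_eq_measure nonneg h_def)
    qed
    \<comment> \<open>The shift of levels used the layers below \<open>N\<close> only; adding the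
      top layer \<open>h N\<close> costs nothing here and completes the sum to
      \<open>n f\<close>.\<close>
    also have "\<dots> \<le> 1 + (\<Sum>i<n. L (h i))"
      unfolding n_def using nonneg[OF hc] by (simp add: h_def)
    also have "(\<Sum>i<n. L (h i)) = L (\<lambda>x. \<Sum>i<n. h i x)" using hc by (subst sum) auto
    also have "(\<lambda>x. \<Sum>i<n. h i x) = (\<lambda>x. real n * f x)"
      unfolding h_def using f by (subst sum_clamp) (auto simp: min_def mult_left_le fun_eq_iff)
    also have "L (\<lambda>x. real n * f x) = real n * L f" by (rule scale[OF f(1)])
    finally have "real n * (\<integral>x. f x \<partial>rep_measure) \<le> 1 + real n * L f" .
    then show ?thesis using n unfolding n_def[symmetric] by (simp add: field_simps)
  qed
  have "(\<lambda>N. L f + inverse (real (Suc N))) \<longlonglongrightarrow> L f + 0"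
    by (intro tendsto_intros LIMSEQ_inverse_real_of_nat)
  then show ?thesis using le by (intro LIMSEQ_le_const[where X="\<lambda>N. L f + inverse (real (Suc N))"]) auto
qed

text \<open>The one-sided estimate suffices, since it applies to \<open>f\<close> and to
  \<open>- f\<close>. The affine map \<open>(g + B) / (2 B)\<close> brings a function bounded by
  \<open>B\<close> into the range \<open>[0, 1]\<close>.\<close>

lemma integral_rep:
  assumes f: "continuous_on UNIV f"
  shows "(\<integral>x. f x \<partial>rep_measure) = L f"
proof -
  interpret prob_space rep_measure by (rule prob_space_rep_measure)
  have le: "(\<integral>x. g x \<partial>rep_measure) \<le> L g" if g: "continuous_on UNIV g" for g
  proof -
    have "bounded (range g)" using compact_continuous_image[OF g compact_space] by (rule compact_imp_bounded)
    then obtain B where B: "0 < B" "\<And>x. norm (g x) \<le> B" by (auto simp: bounded_pos)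
    have "(\<integral>x. 1/(2*B) * (g x + B) \<partial>rep_measure) \<le> L (\<lambda>x. 1/(2*B) * (g x + B))"
    proof (rule integral_rep_le)
      fix x
      have "- B \<le> g x" "g x \<le> B" using B(2)[of x] by auto
      then show "0 \<le> 1/(2*B) * (g x + B)" "1/(2*B) * (g x + B) \<le> 1" using B(1) by (auto simp: field_simps)
    qed (intro continuous_intros g)
    also have "L (\<lambda>x. 1/(2*B) * (g x + B)) = 1/(2*B) * L (\<lambda>x. g x + B)"
      by (rule scale) (intro continuous_intros g)
    also have "L (\<lambda>x. g x + B) = L g + B" using add[OF g, of "\<lambda>x. B"] by (simp add: const)
    also have "(\<integral>x. 1/(2*B) * (g x + B) \<partial>rep_measure) = 1/(2*B) * ((\<integral>x. g x \<partial>rep_measure) + B)"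
      using bounded_integrable_rep[OF g] by (simp add: prob_space[simplified])
    finally show ?thesis using B(1) by (simp add: divide_le_cancel)
  qed
  show ?thesis
    using le[OF f] le[OF continuous_on_minus[OF f]] diff[of "\<lambda>x. 0" f] f by (simp add: const)
qed

end

section \<open>Integrals of functions bounded above\<close>

lemma nn_integral_mix_measure:
  fixes f :: "'z::topological_space \<Rightarrow> ennreal"
  assumes s: "sets \<mu> = sets borel" "sets \<nu> = sets borel" and f: "f \<in> borel_measurable borel"
  shows "(\<integral>\<^sup>+x. f x \<partial>mix_measure t \<mu> \<nu>) =
    ennreal t * (\<integral>\<^sup>+x. f x \<partial>\<mu>) + ennreal (1 - t) * (\<integral>\<^sup>+x. f x \<partial>\<nu>)"
  using f
proof (induction rule: borel_measurable_induct)
  note cs = measurable_cong_sets[OF s(1) refl] measurable_cong_sets[OF s(2) refl]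
    measurable_cong_sets[OF sets_mix_measure refl]
  {
    case (cong f g)
    then have "f = g" by (simp add: fun_eq_iff)
    then show ?case using cong by simp
  next
    case (set A)
    then show ?case using s by (simp add: emeasure_mix_measure)
  next
    case (mult u c)
    then show ?case by (simp add: nn_integral_cmult cs algebra_simps)
  next
    case (add u v)
    then show ?case by (simp add: nn_integral_add cs algebra_simps)
  next
    case (seq U)
    have "U i x \<le> U j x" if "i \<le> j" for i j x
      using incseqD[OF seq.hyps(3) that] by (simp add: le_fun_def)
    then have inc: "incseq (\<lambda>i. integral\<^sup>N \<mu> (U i))" "incseq (\<lambda>i. integral\<^sup>N \<nu> (U i))"
      by (simp_all add: incseq_def nn_integral_mono)
    have SUP: "(\<integral>\<^sup>+x. (SUP i. U i) x \<partial>M) = (SUP i. integral\<^sup>N M (U i))" if "sets M = sets borel" for M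
      using nn_integral_monotone_convergence_SUP[OF seq.hyps(3), of M] seq.hyps(1)
      by (simp add: image_comp measurable_cong_sets[OF that refl])
    have "incseq (\<lambda>i. ennreal t * integral\<^sup>N \<mu> (U i))" "incseq (\<lambda>i. ennreal (1 - t) * integral\<^sup>N \<nu> (U i))"
      using inc by (simp_all add: incseq_def mult_left_mono)
    then show ?case
      unfolding SUP[OF s(1)] SUP[OF s(2)] SUP[OF sets_mix_measure] seq.IH
      by (simp add: SUP_mult_left_ennreal ennreal_SUP_add)
  }
qed

lemma borel_probsD:
  assumes "\<mu> \<in> borel_probs"
  shows "prob_space \<mu>" "sets \<mu> = sets borel" "space \<mu> = UNIV" "emeasure \<mu> UNIV = 1"
    "borel_measurable \<mu> = borel_measurable borel"
proof -
  show 1: "prob_space \<mu>" and 2: "sets \<mu> = sets borel" using assms by (auto simp: borel_probs_def)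
  show 3: "space \<mu> = UNIV" using sets_eq_imp_space_eq[OF 2] by simp
  show "emeasure \<mu> UNIV = 1" using prob_space.emeasure_space_1[OF 1] 3 by simp
  show "borel_measurable \<mu> = borel_measurable borel" by (rule measurable_cong_sets[OF 2 refl])
qed

lemma return_in_borel_probs: "return borel x \<in> borel_probs"
  by (simp add: borel_probs_def prob_space_return)

text \<open>For \<open>f\<close> bounded by \<open>K\<close> this is the integral of the nonnegative
  function \<open>K - f\<close>. It replaces the difference of two integrals by a single
  \<open>nn_integral\<close>, to which additivity and monotone convergence apply directly.\<close>

definition deficit :: "'x measure \<Rightarrow> real \<Rightarrow> ('x \<Rightarrow> ereal) \<Rightarrow> ereal" where
  "deficit \<mu> K f = enn2ereal (\<integral>\<^sup>+x. e2ennreal (ereal K - f x) \<partial>\<mu>)"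

lemma deficit_nonneg: "0 \<le> deficit \<mu> K f"
  by (simp add: deficit_def)

text \<open>Pointwise, \<open>K - f\<close> plus the positive part of \<open>f\<close> equals
  \<open>K\<close> plus the negative part, also where \<open>f\<close> is -\<infinity> and both
  sides are infinite. The integral of the positive part is at most \<open>K\<close>, so it can be
  cancelled.\<close>

lemma ereal_integral_eq_deficit:
  assumes \<mu>: "\<mu> \<in> borel_probs" and f: "f \<in> borel_measurable borel" "\<And>x. f x \<le> ereal K" "0 \<le> K"
  shows "ereal_integral \<mu> f = ereal K - deficit \<mu> K f"
proof -
  note [measurable] = f(1) and [measurable_cong] = borel_probsD(2)[OF \<mu>]
  let ?I = "\<integral>\<^sup>+x. e2ennreal (ereal K - f x) \<partial>\<mu>" and ?P = "\<integral>\<^sup>+x. e2ennreal (f x) \<partial>\<mu>"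
    and ?N = "\<integral>\<^sup>+x. e2ennreal (- f x) \<partial>\<mu>"
  have pt: "e2ennreal (ereal K - f x) + e2ennreal (f x) = ennreal K + e2ennreal (- f x)" for x
    using f(2)[of x] f(3)
    by (cases "f x"; cases "0 \<le> real_of_ereal (f x)")
      (auto simp: ennreal_neg e2ennreal_infty simp flip: ennreal_plus)
  have "?I + ?P = (\<integral>\<^sup>+x. e2ennreal (ereal K - f x) + e2ennreal (f x) \<partial>\<mu>)"
    by (rule nn_integral_add[symmetric]) measurable
  also have "\<dots> = (\<integral>\<^sup>+x. ennreal K \<partial>\<mu>) + ?N"
    unfolding pt by (rule nn_integral_add) measurable
  also have "(\<integral>\<^sup>+x. ennreal K \<partial>\<mu>) = ennreal K" using borel_probsD[OF \<mu>] by simp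
  finally have eq: "?I + ?P = ennreal K + ?N" .
  have "?P \<le> (\<integral>\<^sup>+x. ennreal K \<partial>\<mu>)"
    using f by (intro nn_integral_mono) (metis e2ennreal_ereal e2ennreal_mono)
  also have "\<dots> = ennreal K" using borel_probsD[OF \<mu>] by simp
  finally have P: "?P \<le> ennreal K" .
  have "enn2ereal ?I + enn2ereal ?P = ereal K + enn2ereal ?N"
    using arg_cong[OF eq, of enn2ereal] f(3) by (simp add: plus_ennreal.rep_eq)
  moreover have "enn2ereal ?P \<le> ereal K" using P f(3) by (simp add: less_eq_ennreal.rep_eq)
  moreover have "0 \<le> enn2ereal ?I" "0 \<le> enn2ereal ?N" "0 \<le> enn2ereal ?P" by simp_all
  ultimately show ?thesis
    unfolding ereal_integral_def deficit_def
    by (cases "enn2ereal ?I"; cases "enn2ereal ?P"; cases "enn2ereal ?N") auto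
qed

lemma deficit_mono:
  assumes "\<And>x. f x \<le> g x"
  shows "deficit \<mu> K g \<le> deficit \<mu> K f"
  unfolding deficit_def using assms
  by (simp add: less_eq_ennreal.rep_eq[symmetric] nn_integral_mono e2ennreal_mono ereal_minus_mono)

lemma Bb_measurable: "f \<in> Bb \<Longrightarrow> f \<in> borel_measurable borel"
  by (simp add: Bb_def)

text \<open>Deficits are comparable only for the same \<open>K\<close>, hence a common nonnegative
  bound for several functions.\<close>

lemma Bb_bound:
  assumes "finite F" "F \<subseteq> Bb"
  obtains K where "0 \<le> K" "\<And>f x. f \<in> F \<Longrightarrow> f x \<le> ereal K"
proof -
  have "\<exists>K\<ge>0. \<forall>f\<in>F. \<forall>x. f x \<le> ereal K"
    using assms
  proof (induction rule: finite_induct)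
    case (insert f F)
    then obtain K L where KL: "0 \<le> K" "\<forall>f\<in>F. \<forall>x. f x \<le> ereal K" "\<forall>x. f x \<le> ereal L"
      by (auto simp: Bb_def)
    have "ereal K \<le> ereal (max K L)" "ereal L \<le> ereal (max K L)" by simp_all
    with KL show ?case
      by (intro exI[of _ "max K L"]) (fastforce intro: order_trans)
  qed auto
  then show ?thesis using that by blast
qed

lemma ereal_integral_less_top:
  assumes "\<mu> \<in> borel_probs" "f \<in> Bb"
  shows "ereal_integral \<mu> f < \<infinity>"
proof -
  obtain K where K: "0 \<le> K" "\<And>x. f x \<le> ereal K" using Bb_bound[of "{f}"] assms by (metis empty_subsetI finite.intros insertI1 insert_subset)
  show ?thesis
    using ereal_integral_eq_deficit[OF assms(1) Bb_measurable[OF assms(2)] K(2,1)] deficit_nonneg[of \<mu> K f]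
    by (cases "deficit \<mu> K f") auto
qed

lemma ereal_integral_mono:
  assumes "\<mu> \<in> borel_probs" "f \<in> Bb" "g \<in> Bb" "\<And>x. f x \<le> g x"
  shows "ereal_integral \<mu> f \<le> ereal_integral \<mu> g"
proof -
  obtain K where K: "0 \<le> K" "\<And>x. f x \<le> ereal K" "\<And>x. g x \<le> ereal K" using Bb_bound[of "{f, g}"] assms by (metis empty_subsetI finite.intros insertI1 insertI2 insert_subset)
  show ?thesis
    using ereal_integral_eq_deficit[OF assms(1) Bb_measurable[OF assms(2)] K(2,1)]
      ereal_integral_eq_deficit[OF assms(1) Bb_measurable[OF assms(3)] K(3,1)]
      deficit_mono[of f g \<mu> K] assms(4) by (simp add: ereal_minus_mono)
qed

lemma ereal_integral_add_const:
  assumes "\<mu> \<in> borel_probs" "f \<in> Bb"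
  shows "ereal_integral \<mu> (\<lambda>x. f x + ereal k) = ereal_integral \<mu> f + ereal k"
proof -
  obtain K0 where K0: "0 \<le> K0" "\<And>x. f x \<le> ereal K0" using Bb_bound[of "{f}"] assms by (metis empty_subsetI finite.intros insertI1 insert_subset)
  \<comment> \<open>Adding \<open>\<bar>k\<bar>\<close> keeps the shifted bound \<open>K + k\<close>
    nonnegative; the deficits of \<open>f\<close> and \<open>f + k\<close> then coincide.\<close>
  define K where "K = K0 + \<bar>k\<bar>"
  have K: "0 \<le> K" "f x \<le> ereal K" "0 \<le> K + k" for x
    using K0(1) order_trans[OF K0(2)[of x], of "ereal K"] by (simp_all add: K_def)
  have m: "(\<lambda>x. f x + ereal k) \<in> borel_measurable borel" using Bb_measurable[OF assms(2)] by measurable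
  have b: "f x + ereal k \<le> ereal (K + k)" for x using K(2)[of x] by (cases "f x") auto
  have "ereal (K + k) - (f x + ereal k) = ereal K - f x" for x by (cases "f x") auto
  then have "deficit \<mu> (K + k) (\<lambda>x. f x + ereal k) = deficit \<mu> K f" by (simp add: deficit_def)
  then show ?thesis
    using ereal_integral_eq_deficit[OF assms(1) Bb_measurable[OF assms(2)] K(2,1)]
      ereal_integral_eq_deficit[OF assms(1) m b K(3)] deficit_nonneg[of \<mu> K f]
    by (cases "deficit \<mu> K f") auto
qed

text \<open>For deficits the hypothesis becomes an inequality between nonnegative functions in the
  opposite direction, which integrates by additivity. The cases \<open>t = 0\<close> and
  \<open>t = 1\<close> are split off because a zero weight annihilates infinite values.\<close>

lemma ereal_integral_convex:
  assumes \<mu>: "\<mu> \<in> borel_probs" and Bb: "f \<in> Bb" "g \<in> Bb" "h \<in> Bb" and t: "0 \<le> t" "t \<le> 1"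
    and le: "\<And>x. h x \<le> ereal t * f x + ereal (1 - t) * g x"
  shows "ereal_integral \<mu> h \<le> ereal t * ereal_integral \<mu> f + ereal (1 - t) * ereal_integral \<mu> g"
proof -
  obtain K where K: "0 \<le> K" "\<And>x. f x \<le> ereal K" "\<And>x. g x \<le> ereal K" "\<And>x. h x \<le> ereal K"
    using Bb_bound[of "{f, g, h}"] Bb by (metis empty_subsetI finite.intros insertI1 insertI2 insert_subset)
  note [measurable] = Bb[THEN Bb_measurable] and [measurable_cong] = borel_probsD(2)[OF \<mu>]
  have pt: "ennreal t * e2ennreal (ereal K - f x) + ennreal (1 - t) * e2ennreal (ereal K - g x)
      \<le> e2ennreal (ereal K - h x)" for x
  proof -
    have nn: "0 \<le> ereal K - f x" "0 \<le> ereal K - g x" "0 \<le> ereal K - h x"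
      using K(2-4)[of x] by (cases "f x"; cases "g x"; cases "h x"; auto)+
    have "ereal t * (ereal K - f x) + ereal (1 - t) * (ereal K - g x) \<le> ereal K - h x"
      using K(2-4)[of x] le[of x] t
      by (cases "f x"; cases "g x"; cases "h x"; cases "t = 0"; cases "t = 1") (auto simp: algebra_simps)
    then show ?thesis
      using nn t
      by (simp add: less_eq_ennreal.rep_eq plus_ennreal.rep_eq times_ennreal.rep_eq enn2ereal_e2ennreal)
  qed
  have "ereal t * deficit \<mu> K f + ereal (1 - t) * deficit \<mu> K g =
      enn2ereal (ennreal t * (\<integral>\<^sup>+x. e2ennreal (ereal K - f x) \<partial>\<mu>)
        + ennreal (1 - t) * (\<integral>\<^sup>+x. e2ennreal (ereal K - g x) \<partial>\<mu>))"
    using t by (simp add: deficit_def plus_ennreal.rep_eq times_ennreal.rep_eq)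
  also have "\<dots> = enn2ereal (\<integral>\<^sup>+x. ennreal t * e2ennreal (ereal K - f x) + ennreal (1 - t) * e2ennreal (ereal K - g x) \<partial>\<mu>)"
    by (simp add: nn_integral_add nn_integral_cmult)
  also have "\<dots> \<le> deficit \<mu> K h"
    unfolding deficit_def less_eq_ennreal.rep_eq[symmetric] by (intro nn_integral_mono pt)
  finally show ?thesis
    using ereal_integral_eq_deficit[OF \<mu> Bb_measurable[OF Bb(1)] K(2,1)]
      ereal_integral_eq_deficit[OF \<mu> Bb_measurable[OF Bb(2)] K(3,1)]
      ereal_integral_eq_deficit[OF \<mu> Bb_measurable[OF Bb(3)] K(4,1)]
      deficit_nonneg[of \<mu> K f] deficit_nonneg[of \<mu> K g] deficit_nonneg[of \<mu> K h] t
    by (cases "deficit \<mu> K f"; cases "deficit \<mu> K g"; cases "deficit \<mu> K h"; cases "t = 0"; cases "t = 1")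
      (auto simp: algebra_simps)
qed

lemma ereal_integral_mix_measure:
  assumes \<mu>: "\<mu> \<in> borel_probs" and \<nu>: "\<nu> \<in> borel_probs" and f: "f \<in> Bb" and t: "0 \<le> t" "t \<le> 1"
  shows "ereal_integral (mix_measure t \<mu> \<nu>) f =
    ereal t * ereal_integral \<mu> f + ereal (1 - t) * ereal_integral \<nu> f"
proof -
  obtain K where K: "0 \<le> K" "\<And>x. f x \<le> ereal K" using Bb_bound[of "{f}"] f by (metis empty_subsetI finite.intros insertI1 insert_subset)
  note m[measurable] = Bb_measurable[OF f]
  have "deficit (mix_measure t \<mu> \<nu>) K f = ereal t * deficit \<mu> K f + ereal (1 - t) * deficit \<nu> K f"
    unfolding deficit_def using \<mu> \<nu> t
    by (subst nn_integral_mix_measure)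
      (auto simp: plus_ennreal.rep_eq times_ennreal.rep_eq borel_probs_def)
  then show ?thesis
    using ereal_integral_eq_deficit[OF \<mu> m K(2,1)] ereal_integral_eq_deficit[OF \<nu> m K(2,1)]
      ereal_integral_eq_deficit[OF mix_measure_in_borel_probs[OF \<mu> \<nu> t] m K(2,1)]
      deficit_nonneg[of \<mu> K f] deficit_nonneg[of \<nu> K f] t
    by (cases "deficit \<mu> K f"; cases "deficit \<nu> K f"; cases "t = 0"; cases "t = 1")
      (auto simp: algebra_simps)
qed

lemma ereal_integral_return:
  assumes "f \<in> Bb"
  shows "ereal_integral (return borel x) f = f x"
proof -
  obtain K where K: "0 \<le> K" "\<And>x. f x \<le> ereal K" using Bb_bound[of "{f}"] assms by (metis empty_subsetI finite.intros insertI1 insert_subset)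
  note m[measurable] = Bb_measurable[OF assms]
  have "0 \<le> ereal K - f x" using K(2)[of x] by (cases "f x") auto
  then have "deficit (return borel x) K f = ereal K - f x"
    unfolding deficit_def by (subst nn_integral_return) (auto simp: enn2ereal_e2ennreal)
  then show ?thesis
    using ereal_integral_eq_deficit[OF return_in_borel_probs m K(2,1)] K(2)[of x]
    by (cases "f x") auto
qed

lemma bcontfun_measurable [measurable]: "apply_bcontfun g \<in> borel_measurable borel"
  by (intro borel_measurable_continuous_onI) simp

lemma abs_bcontfun_le_norm: "\<bar>apply_bcontfun (g :: 'z::topological_space \<Rightarrow>\<^sub>C real) x\<bar> \<le> norm g"
  using norm_bounded[of g x] by simp

lemma bcontfun_in_Bb: "(\<lambda>x. ereal (apply_bcontfun g x)) \<in> Bb"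
proof -
  have "apply_bcontfun g x \<le> norm g" for x using abs_bcontfun_le_norm[of g x] by simp
  then show ?thesis by (auto simp: Bb_def)
qed

lemma integrable_bcontfun:
  assumes "\<mu> \<in> borel_probs"
  shows "integrable \<mu> (apply_bcontfun (g :: 'z::metric_space \<Rightarrow>\<^sub>C real))"
proof -
  interpret prob_space \<mu> using borel_probsD[OF assms] by simp
  show ?thesis
    using abs_bcontfun_le_norm[of g] borel_probsD[OF assms]
    by (intro integrable_const_bound[where B="norm g"]) auto
qed

lemma ereal_integral_bcontfun:
  assumes \<mu>: "\<mu> \<in> borel_probs"
  shows "ereal_integral \<mu> (\<lambda>x. ereal (apply_bcontfun g x)) = ereal (\<integral>x. apply_bcontfun g x \<partial>\<mu>)"
proof -
  interpret prob_space \<mu> using borel_probsD[OF \<mu>] by simp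
  have le: "apply_bcontfun g x \<le> norm g" for x using abs_bcontfun_le_norm[of g x] by simp
  have "(\<integral>\<^sup>+x. e2ennreal (ereal (norm g) - ereal (apply_bcontfun g x)) \<partial>\<mu>) =
      (\<integral>\<^sup>+x. ennreal (norm g - apply_bcontfun g x) \<partial>\<mu>)" by simp
  also have "\<dots> = ennreal (\<integral>x. norm g - apply_bcontfun g x \<partial>\<mu>)"
    using le integrable_bcontfun[OF \<mu>] by (intro nn_integral_eq_integral) auto
  also have "(\<integral>x. norm g - apply_bcontfun g x \<partial>\<mu>) = norm g - (\<integral>x. apply_bcontfun g x \<partial>\<mu>)"
    using integrable_bcontfun[OF \<mu>] by (simp add: prob_space)
  finally have "deficit \<mu> (norm g) (\<lambda>x. ereal (apply_bcontfun g x)) =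
      ereal (norm g - (\<integral>x. apply_bcontfun g x \<partial>\<mu>))"
    unfolding deficit_def using integral_le_const[OF integrable_bcontfun[OF \<mu>], of g "norm g"] le by simp
  then show ?thesis
    using ereal_integral_eq_deficit[OF \<mu> Bb_measurable[OF bcontfun_in_Bb], of g "norm g"] le by simp
qed

lemma integral_mix_measure:
  assumes "\<mu> \<in> borel_probs" "\<nu> \<in> borel_probs" "0 \<le> t" "t \<le> 1"
  shows "(\<integral>x. apply_bcontfun g x \<partial>mix_measure t \<mu> \<nu>) =
    t * (\<integral>x. apply_bcontfun g x \<partial>\<mu>) + (1 - t) * (\<integral>x. apply_bcontfun g x \<partial>\<nu>)"
  using ereal_integral_mix_measure[OF assms(1,2) bcontfun_in_Bb assms(3,4), of g] assms
  by (simp add: ereal_integral_bcontfun mix_measure_in_borel_probs)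

text \<open>Lets joint convexity of a cost be applied with the first measure held fixed.\<close>

lemma mix_measure_same:
  assumes "\<mu> \<in> borel_probs" "0 \<le> t" "t \<le> 1"
  shows "mix_measure t \<mu> \<mu> = \<mu>"
proof (rule measure_eqI)
  show "sets (mix_measure t \<mu> \<mu>) = sets \<mu>" using borel_probsD[OF assms(1)] by simp
  fix A assume "A \<in> sets (mix_measure t \<mu> \<mu>)"
  then have "emeasure (mix_measure t \<mu> \<mu>) A = (ennreal t + ennreal (1 - t)) * emeasure \<mu> A"
    using borel_probsD[OF assms(1)] by (simp add: emeasure_mix_measure distrib_right)
  then show "emeasure (mix_measure t \<mu> \<mu>) A = emeasure \<mu> A"
    using assms by (simp flip: ennreal_plus)
qed

lemma integral_return_bcontfun: "(\<integral>y. apply_bcontfun g y \<partial>return borel x) = (apply_bcontfun g x :: real)"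
  by (simp add: integral_return)

section \<open>The weak* topology\<close>

lemma apply_const_bcontfun [simp]: "apply_bcontfun (const_bcontfun k) x = k"
  by transfer simp

lemma apply_Bcontfun:
  fixes f :: "'z::metric_space \<Rightarrow> real"
  assumes "compact (UNIV :: 'z set)" "continuous_on UNIV f"
  shows "apply_bcontfun (Bcontfun f) = f"
  using assms compact_imp_bounded[OF compact_continuous_image[OF assms(2,1)]]
  by (intro Bcontfun_inverse) (simp add: bcontfun_def)

lemma riesz_representation:
  fixes l :: "('z::metric_space \<Rightarrow>\<^sub>C real) \<Rightarrow> real"
  assumes cpt: "compact (UNIV :: 'z set)" and lin: "linear l"
    and pos: "\<And>g. (\<And>y. 0 \<le> apply_bcontfun g y) \<Longrightarrow> 0 \<le> l g" and one: "l (const_bcontfun 1) = 1"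
  obtains \<sigma> where "\<sigma> \<in> borel_probs" "\<And>g. (\<integral>y. apply_bcontfun g y \<partial>\<sigma>) = l g"
proof -
  note [simp] = apply_Bcontfun[OF cpt]
  interpret R: positive_functional "\<lambda>f. l (Bcontfun f)"
  proof
    fix f g :: "'z \<Rightarrow> real" and c :: real assume f: "continuous_on UNIV f"
    have "Bcontfun (\<lambda>x. c * f x) = c *\<^sub>R Bcontfun f"
      by (rule bcontfun_eqI) (simp add: f continuous_on_mult_left)
    then show "l (Bcontfun (\<lambda>x. c * f x)) = c * l (Bcontfun f)" by (simp add: linear_cmul[OF lin])
    show "0 \<le> l (Bcontfun f)" if "\<And>x. 0 \<le> f x" using that f by (intro pos) simp
    assume g: "continuous_on UNIV g"
    have "Bcontfun (\<lambda>x. f x + g x) = Bcontfun f + Bcontfun g"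
      by (rule bcontfun_eqI) (simp add: f g continuous_on_add)
    then show "l (Bcontfun (\<lambda>x. f x + g x)) = l (Bcontfun f) + l (Bcontfun g)"
      by (simp add: linear_add[OF lin])
  next
    have "Bcontfun (\<lambda>x. 1) = (const_bcontfun 1 :: 'z \<Rightarrow>\<^sub>C real)" by (rule bcontfun_eqI) simp
    then show "l (Bcontfun (\<lambda>x. 1)) = 1" using one by simp
  qed (fact cpt)
  show ?thesis
  proof (rule that)
    show "R.rep_measure \<in> borel_probs" by (simp add: borel_probs_def R.prob_space_rep_measure)
    show "(\<integral>y. apply_bcontfun g y \<partial>R.rep_measure) = l g" for g
      using R.integral_rep[of "apply_bcontfun g"] by (simp add: apply_bcontfun_inverse)
  qed
qed

lemma topspace_weakstar [simp]: "topspace weakstar = borel_probs"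
  by (simp add: weakstar_def topspace_pullback_topology)

lemma continuous_map_weakstar_integral:
  "continuous_map weakstar euclideanreal (\<lambda>\<mu>. \<integral>z. apply_bcontfun (g :: 'z::metric_space \<Rightarrow>\<^sub>C real) z \<partial>\<mu>)"
proof -
  have "continuous_map euclidean euclideanreal (\<lambda>\<phi> :: ('z \<Rightarrow>\<^sub>C real) \<Rightarrow> real. \<phi> g)" by simp
  from continuous_map_pullback[OF this] show ?thesis unfolding weakstar_def comp_def .
qed

lemma openin_weakstar_integral:
  fixes g :: "'z::metric_space \<Rightarrow>\<^sub>C real"
  assumes "open S"
  shows "openin weakstar {\<mu> \<in> borel_probs. (\<integral>z. apply_bcontfun g z \<partial>\<mu>) \<in> S}"
  using openin_continuous_map_preimage[OF continuous_map_weakstar_integral, of S g] assms by simp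

text \<open>The coordinate belonging to \<open>g\<close> of the embedded Dirac mass at
  \<open>x\<close> is \<open>g x\<close>, which is continuous in \<open>x\<close>.\<close>

lemma continuous_map_return: "continuous_map euclidean weakstar (return borel)"
  unfolding weakstar_def
proof (rule continuous_map_pullback')
  show "continuous_map euclidean euclidean ((\<lambda>\<mu> g. \<integral>z. apply_bcontfun g z \<partial>\<mu> :: real) \<circ> return borel)"
    by (auto simp: comp_def integral_return_bcontfun intro!: continuous_on_coordinatewise_then_product)
qed (auto simp: return_in_borel_probs)

text \<open>Banach-Alaoglu by Tychonoff: the normalised positive linear functionals form a closed
  subset \<open>D\<close> of a product of compact intervals, and by the Riesz theorem
  \<open>D\<close> is the image of the probability measures. Weak* open sets are preimages of open
  sets, so a finite subcover of \<open>D\<close> pulls back.\<close>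

theorem compact_space_weakstar:
  assumes cpt: "compact (UNIV :: 'z::metric_space set)"
  shows "compact_space (weakstar :: 'z measure topology)"
proof -
  define \<Phi> where "\<Phi> = (\<lambda>\<mu> (g :: 'z \<Rightarrow>\<^sub>C real). \<integral>z. apply_bcontfun g z \<partial>\<mu>)"
  define D where "D = {\<phi> :: ('z \<Rightarrow>\<^sub>C real) \<Rightarrow> real. (\<forall>f g. \<phi> (f + g) = \<phi> f + \<phi> g) \<and> (\<forall>c g. \<phi> (c *\<^sub>R g) = c * \<phi> g)
     \<and> (\<forall>g. (\<forall>y. 0 \<le> apply_bcontfun g y) \<longrightarrow> 0 \<le> \<phi> g) \<and> \<phi> (const_bcontfun 1) = 1}"
  have DD: "\<phi> (f + g) = \<phi> f + \<phi> g" "\<phi> (c *\<^sub>R g) = c * \<phi> g"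
    "(\<And>y. 0 \<le> apply_bcontfun g y) \<Longrightarrow> 0 \<le> \<phi> g" "\<phi> (const_bcontfun 1) = 1" if "\<phi> \<in> D" for \<phi> f g c
    using that by (auto simp: D_def)
  have D_le: "\<phi> g \<le> norm g" if \<phi>: "\<phi> \<in> D" for \<phi> g
  proof -
    \<comment> \<open>Positivity is tested on the nonnegative function \<open>norm g - g\<close>;
      this yields boundedness of \<phi> without any continuity assumption.\<close>
    have "0 \<le> \<phi> (norm g *\<^sub>R const_bcontfun 1 + (-1) *\<^sub>R g)"
      using abs_bcontfun_le_norm[of g] by (intro DD(3)[OF \<phi>]) (auto simp: abs_le_iff)
    also have "\<dots> = norm g - \<phi> g"
      unfolding DD(1)[OF \<phi>] DD(2)[OF \<phi>] DD(4)[OF \<phi>] by simp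
    finally show ?thesis by simp
  qed
  have "D \<subseteq> PiE UNIV (\<lambda>g. {- norm g .. norm g})"
  proof
    fix \<phi> assume \<phi>: "\<phi> \<in> D"
    have "- norm g \<le> \<phi> g" for g
    proof -
      have "\<phi> ((-1) *\<^sub>R g) = (-1) * \<phi> g" by (rule DD(2)[OF \<phi>])
      then show ?thesis using D_le[OF \<phi>, of "(-1) *\<^sub>R g"] by simp
    qed
    then show "\<phi> \<in> PiE UNIV (\<lambda>g. {- norm g .. norm g})" using D_le[OF \<phi>] by auto
  qed
  moreover have "compact (PiE UNIV (\<lambda>g :: 'z \<Rightarrow>\<^sub>C real. {- norm g .. norm g}))"
    using compactin_PiE[of "\<lambda>g. euclideanreal" UNIV "\<lambda>g :: 'z \<Rightarrow>\<^sub>C real. {- norm g .. norm g}"]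
    by (simp add: euclidean_product_topology)
  moreover have "closed D"
    unfolding D_def
    by (intro closed_Collect_conj closed_Collect_all closed_Collect_imp open_Collect_const closed_Collect_eq closed_Collect_le
        continuous_intros continuous_on_product_coordinates) 
  ultimately have D: "compact D" by (metis closed_Int_compact inf.absorb1)
  have \<Phi>D: "\<Phi> ` borel_probs = D"
  proof (intro equalityI subsetI)
    fix \<phi> assume "\<phi> \<in> \<Phi> ` borel_probs"
    then obtain \<mu> where \<mu>: "\<mu> \<in> borel_probs" "\<phi> = \<Phi> \<mu>" by auto
    then show "\<phi> \<in> D"
      using integrable_bcontfun[OF \<mu>(1)] borel_probsD(4)[OF \<mu>(1)]
      by (auto simp: D_def \<Phi>_def measure_def borel_probsD(3))
  next
    fix \<phi> assume \<phi>: "\<phi> \<in> D"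
    have "linear \<phi>" using DD(1,2)[OF \<phi>] by (intro linearI) auto
    then obtain \<sigma> where "\<sigma> \<in> borel_probs" "\<And>g. (\<integral>y. apply_bcontfun g y \<partial>\<sigma>) = \<phi> g"
      using riesz_representation[OF cpt \<open>linear \<phi>\<close> DD(3)[OF \<phi>] DD(4)[OF \<phi>]] by blast
    then show "\<phi> \<in> \<Phi> ` borel_probs" by (intro image_eqI[of _ _ \<sigma>]) (auto simp: \<Phi>_def)
  qed
  show ?thesis
    unfolding compact_space_def topspace_weakstar compactin_def
  proof (intro conjI allI impI)
    fix \<U> :: "'z measure set set"
    assume U: "(\<forall>U\<in>\<U>. openin weakstar U) \<and> borel_probs \<subseteq> \<Union> \<U>"
    then have "\<forall>U\<in>\<U>. \<exists>V. open V \<and> U = \<Phi> -` V \<inter> borel_probs"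
      by (simp add: weakstar_def openin_pullback_topology \<Phi>_def)
    then obtain V where V: "\<And>U. U \<in> \<U> \<Longrightarrow> open (V U)" "\<And>U. U \<in> \<U> \<Longrightarrow> U = \<Phi> -` V U \<inter> borel_probs"
      by metis
    have "D \<subseteq> (\<Union>U\<in>\<U>. V U)"
      unfolding \<Phi>D[symmetric]
    proof
      fix \<phi> assume "\<phi> \<in> \<Phi> ` borel_probs"
      then obtain \<mu> where "\<mu> \<in> borel_probs" "\<phi> = \<Phi> \<mu>" by auto
      moreover then obtain U where "U \<in> \<U>" "\<mu> \<in> U" using U by blast
      ultimately show "\<phi> \<in> (\<Union>U\<in>\<U>. V U)" using V(2)[of U] by blast
    qed
    then obtain \<F> where F: "\<F> \<subseteq> \<U>" "finite \<F>" "D \<subseteq> (\<Union>U\<in>\<F>. V U)"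
      using V(1) by (rule_tac compactE_image[OF D])
    have "borel_probs \<subseteq> \<Union> \<F>"
    proof
      fix \<mu> :: "'z measure" assume \<mu>: "\<mu> \<in> borel_probs"
      then have "\<Phi> \<mu> \<in> D" using \<Phi>D by blast
      then obtain U where "U \<in> \<F>" "\<Phi> \<mu> \<in> V U" using F(3) by blast
      then show "\<mu> \<in> \<Union> \<F>" using V(2)[of U] F(1) \<mu> by blast
    qed
    then show "\<exists>\<F>. finite \<F> \<and> \<F> \<subseteq> \<U> \<and> borel_probs \<subseteq> \<Union> \<F>" using F by blast
  qed simp
qed

section \<open>Upper semi-continuous functions and their integrals\<close>

lemma usc_mapD_ereal:
  fixes f :: "'x::metric_space \<Rightarrow> ereal"
  assumes "usc_map euclidean f" "f x < a"
  obtains d where "0 < d" "\<And>y. dist x y < d \<Longrightarrow> f y < a"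
proof -
  have "open {y. f y < a}" using assms(1) by (simp add: usc_map_def)
  then obtain d where "0 < d" "ball x d \<subseteq> {y. f y < a}"
    using assms(2) by (auto simp: open_contains_ball)
  then show ?thesis by (intro that[of d]) auto
qed

text \<open>The approximants are the Lipschitz (Pasch--Hausdorff) regularisations of the truncations of \<open>f\<close>.\<close>

lemma usc_decreasing_continuous_approx:
  fixes f :: "'x::metric_space \<Rightarrow> ereal"
  assumes cpt: "compact (UNIV :: 'x set)" and usc: "usc_map euclidean f" and K: "\<And>x. f x \<le> ereal K"
  obtains h :: "nat \<Rightarrow> 'x \<Rightarrow>\<^sub>C real" where "\<And>n x. apply_bcontfun (h n) x \<le> K" "\<And>n x. f x \<le> ereal (apply_bcontfun (h n) x)"
    "\<And>n x. apply_bcontfun (h (Suc n)) x \<le> apply_bcontfun (h n) x"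
    "\<And>x b. f x < ereal b \<Longrightarrow> \<exists>n. apply_bcontfun (h n) x \<le> b"
proof -
  \<comment> \<open>The summand \<open>\<bar>K\<bar>\<close> puts every truncation level
    \<open>- N n\<close> below \<open>K\<close>, so truncation preserves the bound
    \<open>K\<close>.\<close>
  define N :: "nat \<Rightarrow> real" where "N n = real n + \<bar>K\<bar>" for n
  define F where "F n y = real_of_ereal (max (f y) (ereal (- N n)))" for n y
  have F: "ereal (F n y) = max (f y) (ereal (- N n))" for n y
    using K[of y] by (cases "f y") (auto simp: F_def max_def)
  have FK: "F n y \<le> K" for n y
  proof -
    have "ereal (F n y) \<le> ereal K" unfolding F using K[of y] by (auto simp: N_def)
    then show ?thesis by simp
  qed
  have Fdec: "F (Suc n) y \<le> F n y" for n y
  proof -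
    have "ereal (F (Suc n) y) \<le> ereal (F n y)" unfolding F by (intro max.mono) (auto simp: N_def)
    then show ?thesis by simp
  qed
  have fF: "f y \<le> ereal (F n y)" for n y unfolding F by simp
  define h where "h n x = (SUP y. F n y - real n * dist x y)" for n x
  have summand_le: "F n y - real n * dist x y \<le> K" for n x y
    using FK[of n y] mult_nonneg_nonneg[OF of_nat_0_le_iff[of n] zero_le_dist[of x y]] by linarith
  have bdd: "bdd_above (range (\<lambda>y. F n y - real n * dist x y))" for n x
    using summand_le by (intro bdd_aboveI2)
  have hge: "F n y - real n * dist x y \<le> h n x" for n x y
    unfolding h_def by (rule cSUP_upper[OF UNIV_I bdd])
  have hle: "h n x \<le> B" if "\<And>y. F n y - real n * dist x y \<le> B" for n x B
    unfolding h_def using that by (intro cSUP_least) auto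
  have lip: "h n x \<le> h n z + real n * dist x z" for n x z
  proof (rule hle)
    fix y
    have "real n * dist z y \<le> real n * (dist x z + dist x y)"
      using dist_triangle[of z y x] by (intro mult_left_mono) (auto simp: dist_commute)
    then show "F n y - real n * dist x y \<le> h n z + real n * dist x z"
      using hge[of n y z] by (simp add: algebra_simps)
  qed
  have "continuous_on UNIV (h n)" for n
  proof (rule lipschitz_on_continuous_on)
    show "(real n)-lipschitz_on UNIV (h n)"
    proof (rule lipschitz_onI)
      fix x y
      show "dist (h n x) (h n y) \<le> real n * dist x y"
        using lip[of n x y] lip[of n y x] by (simp add: dist_real_def abs_le_iff dist_commute)
    qed simp
  qed
  note [simp] = apply_Bcontfun[OF cpt this]
  show ?thesis
  proof (rule that[of "\<lambda>n. Bcontfun (h n)"])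
    fix n x
    show "apply_bcontfun (Bcontfun (h n)) x \<le> K" using hle[OF summand_le] by simp
    have "F n x \<le> h n x" using hge[of n x x] by simp
    then show "f x \<le> ereal (apply_bcontfun (Bcontfun (h n)) x)"
      using fF[of x n] order_trans by fastforce
    show "apply_bcontfun (Bcontfun (h (Suc n))) x \<le> apply_bcontfun (Bcontfun (h n)) x"
    proof (simp, rule hle)
      fix y
      have "F (Suc n) y - real (Suc n) * dist x y \<le> F n y - real n * dist x y"
      proof -
        have "real (Suc n) * dist x y = real n * dist x y + dist x y" by (simp add: algebra_simps)
        then show ?thesis using Fdec[of n y] zero_le_dist[of x y] by linarith
      qed
      then show "F (Suc n) y - real (Suc n) * dist x y \<le> h n x" using hge[of n y x] by linarith
    qed
  next
    fix x b assume "f x < ereal b"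
    then obtain d where d: "0 < d" "\<And>y. dist x y < d \<Longrightarrow> f y < ereal b"
      using usc_mapD_ereal[OF usc] by blast
    \<comment> \<open>For points within \<open>d\<close> of \<open>x\<close> the bound
      \<open>b\<close> needs the truncation level to be below \<open>b\<close>, which
      \<open>n1\<close> ensures. For the others the penalty \<open>n * d\<close> must bring
      \<open>K\<close> down to \<open>b\<close>, which \<open>n2\<close> ensures.\<close>
    obtain n1 where n1: "\<bar>b\<bar> \<le> real n1" using real_arch_simple by blast
    obtain n2 where n2: "\<bar>K\<bar> + \<bar>b\<bar> < real n2 * d" using reals_Archimedean3[OF d(1)] by blast
    define n where "n = max n1 n2"
    have n: "- N n \<le> b" "K - real n * d \<le> b"
    proof -
      have "real n1 \<le> real n" "real n2 * d \<le> real n * d" using d(1) by (auto simp: n_def)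
      then show "- N n \<le> b" "K - real n * d \<le> b" using n1 n2 by (auto simp: N_def)
    qed
    have "h n x \<le> b"
    proof (rule hle)
      fix y
      show "F n y - real n * dist x y \<le> b"
      proof (cases "dist x y < d")
        case True
        then have "ereal (F n y) \<le> ereal b" unfolding F using d(2)[OF True] n(1) by auto
        then have "F n y \<le> b" by simp
        moreover have "0 \<le> real n * dist x y" by simp
        ultimately show ?thesis by linarith
      next
        case False
        then have "real n * d \<le> real n * dist x y" by (intro mult_left_mono) auto
        then show ?thesis using FK[of n y] n(2) by linarith
      qed
    qed
    then show "\<exists>n. apply_bcontfun (Bcontfun (h n)) x \<le> b" by auto
  qed
qed

text \<open>Monotone convergence applied to the increasing functions \<open>K - h n\<close>, whose
  supremum is \<open>K - f\<close>, for the decreasing continuous approximants \<open>h n\<close> of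
  \<open>f\<close>.\<close>

lemma USC_continuous_majorant:
  fixes f :: "'x::metric_space \<Rightarrow> ereal"
  assumes cpt: "compact (UNIV :: 'x set)" and usc: "usc_map euclidean f" and Bb: "f \<in> Bb"
    and \<mu>: "\<mu> \<in> borel_probs" and less: "ereal_integral \<mu> f < a"
  obtains h :: "'x \<Rightarrow>\<^sub>C real" where "\<And>x. f x \<le> ereal (apply_bcontfun h x)"
    "ereal (\<integral>x. apply_bcontfun h x \<partial>\<mu>) < a"
proof -
  obtain K where K: "0 \<le> K" "\<And>x. f x \<le> ereal K"
    using Bb_bound[of "{f}"] Bb by (metis empty_subsetI finite.intros insertI1 insert_subset)
  obtain h where h: "\<And>n x. apply_bcontfun (h n) x \<le> K" "\<And>n x. f x \<le> ereal (apply_bcontfun (h n) x)"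
    "\<And>n x. apply_bcontfun (h (Suc n)) x \<le> apply_bcontfun (h n) x"
    "\<And>x b. f x < ereal b \<Longrightarrow> \<exists>n. apply_bcontfun (h n) x \<le> b"
    using usc_decreasing_continuous_approx[OF cpt usc K(2)] by blast
  let ?u = "\<lambda>n x. e2ennreal (ereal K - ereal (apply_bcontfun (h n) x))"
  have inc: "incseq ?u"
    using h(3) by (intro incseq_SucI) (auto simp: le_fun_def intro!: ennreal_leI)
  have sup: "(SUP n. ?u n x) = e2ennreal (ereal K - f x)" for x
  proof (rule antisym)
    show "(SUP n. ?u n x) \<le> e2ennreal (ereal K - f x)"
      using h(2) by (intro SUP_least e2ennreal_mono ereal_minus_mono) auto
    show "e2ennreal (ereal K - f x) \<le> (SUP n. ?u n x)"
    proof (rule dense_le)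
      fix c assume c: "c < e2ennreal (ereal K - f x)"
      then have "c < top" by (rule less_le_trans) simp
      then obtain r where r: "c = ennreal r" "0 \<le> r" by (cases c) auto
      have "ereal r < ereal K - f x"
        using c K(2)[of x] r by (cases "f x") (auto simp: ennreal_less_iff)
      then have "f x < ereal (K - r)" by (cases "f x") auto
      then obtain n where "apply_bcontfun (h n) x \<le> K - r" using h(4) by blast
      then have "c \<le> ?u n x" unfolding r(1) by (simp add: ennreal_leI)
      then show "c \<le> (SUP n. ?u n x)" by (rule order_trans) (rule SUP_upper, simp)
    qed
  qed
  have "(\<integral>\<^sup>+x. e2ennreal (ereal K - f x) \<partial>\<mu>) = (SUP n. integral\<^sup>N \<mu> (?u n))"
    unfolding sup[symmetric]
  proof (rule nn_integral_monotone_convergence_SUP[OF inc])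
    show "?u n \<in> borel_measurable \<mu>" for n
      unfolding borel_probsD(5)[OF \<mu>] by measurable
  qed
  \<comment> \<open>Otherwise all integrals of \<open>?u n\<close> are at most \<open>K - a\<close>;
    so is their supremum, the deficit of \<open>f\<close>, against the assumption
    \<open>less\<close>.\<close>
  moreover have "\<exists>n. ereal K - enn2ereal (integral\<^sup>N \<mu> (?u n)) < a"
  proof (rule ccontr)
    assume "\<not> ?thesis"
    then have ge: "a \<le> ereal K - enn2ereal (integral\<^sup>N \<mu> (?u n))" for n by (auto simp: not_less)
    have "integral\<^sup>N \<mu> (?u n) \<le> e2ennreal (ereal K - a)" for n
    proof -
      have "enn2ereal (integral\<^sup>N \<mu> (?u n)) \<le> ereal K - a"
        using ge[of n] by (cases "enn2ereal (integral\<^sup>N \<mu> (?u n))"; cases a) auto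
      then have "e2ennreal (enn2ereal (integral\<^sup>N \<mu> (?u n))) \<le> e2ennreal (ereal K - a)" by (rule e2ennreal_mono)
      then show ?thesis by simp
    qed
    then have "(\<integral>\<^sup>+x. e2ennreal (ereal K - f x) \<partial>\<mu>) \<le> e2ennreal (ereal K - a)"
      unfolding calculation by (rule SUP_least)
    moreover have "0 \<le> ereal K - a"
      using ge[of 0] enn2ereal_nonneg[of "integral\<^sup>N \<mu> (?u 0)"] by (cases "enn2ereal (integral\<^sup>N \<mu> (?u 0))"; cases a) auto
    ultimately have "deficit \<mu> K f \<le> ereal K - a"
      unfolding deficit_def by (simp add: less_eq_ennreal.rep_eq enn2ereal_e2ennreal)
    then have "a \<le> ereal K - deficit \<mu> K f"
      using deficit_nonneg[of \<mu> K f] by (cases "deficit \<mu> K f"; cases a) auto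
    then show False
      using less ereal_integral_eq_deficit[OF \<mu> Bb_measurable[OF Bb] K(2,1)] by simp
  qed
  then obtain n where n: "ereal K - deficit \<mu> K (\<lambda>x. ereal (apply_bcontfun (h n) x)) < a"
    by (auto simp: deficit_def)
  have "ereal_integral \<mu> (\<lambda>x. ereal (apply_bcontfun (h n) x)) =
      ereal K - deficit \<mu> K (\<lambda>x. ereal (apply_bcontfun (h n) x))"
    using h(1) K(1) by (intro ereal_integral_eq_deficit[OF \<mu>] Bb_measurable bcontfun_in_Bb) auto
  then show ?thesis
    using n h(2) by (intro that[of "h n"]) (auto simp: ereal_integral_bcontfun[OF \<mu>])
qed

text \<open>A continuous majorant \<open>h\<close> of \<open>f\<close> whose integral is still below
  \<open>a\<close> at \<mu> defines a weak* neighbourhood of \<mu> on which the integral of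
  \<open>f\<close> stays below \<open>a\<close>.\<close>

lemma openin_ereal_integral_less:
  fixes f :: "'x::metric_space \<Rightarrow> ereal"
  assumes cpt: "compact (UNIV :: 'x set)" and usc: "usc_map euclidean f" and Bb: "f \<in> Bb"
  shows "openin weakstar {\<mu> \<in> borel_probs. ereal_integral \<mu> f < a}"
proof (subst openin_subopen, intro ballI)
  fix \<mu> :: "'x measure" assume "\<mu> \<in> {\<mu> \<in> borel_probs. ereal_integral \<mu> f < a}"
  then have \<mu>: "\<mu> \<in> borel_probs" "ereal_integral \<mu> f < a" by auto
  obtain h :: "'x \<Rightarrow>\<^sub>C real" where h: "\<And>x. f x \<le> ereal (apply_bcontfun h x)"
    "ereal (\<integral>x. apply_bcontfun h x \<partial>\<mu>) < a"
    using USC_continuous_majorant[OF cpt usc Bb \<mu>] by blast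
  have "open {r. ereal r < a}" by (intro open_Collect_less continuous_intros)
  then have "openin weakstar {\<mu> \<in> borel_probs. ereal (\<integral>x. apply_bcontfun h x \<partial>\<mu>) < a}"
    using openin_weakstar_integral[of "{r. ereal r < a}" h] by simp
  moreover have "ereal_integral \<nu> f < a" if \<nu>: "\<nu> \<in> borel_probs" "ereal (\<integral>x. apply_bcontfun h x \<partial>\<nu>) < a" for \<nu>
    using ereal_integral_mono[OF \<nu>(1) Bb bcontfun_in_Bb h(1)] \<nu> by (simp add: ereal_integral_bcontfun)
  ultimately show "\<exists>T. openin weakstar T \<and> \<mu> \<in> T \<and> T \<subseteq> {\<mu> \<in> borel_probs. ereal_integral \<mu> f < a}"
    using \<mu>(1) h(2) by (intro exI[of _ "{\<mu> \<in> borel_probs. ereal (\<integral>x. apply_bcontfun h x \<partial>\<mu>) < a}"]) auto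
qed

section \<open>Kantorovich operators and transport costs\<close>

text \<open>A linear \<open>l\<close> below the increment \<open>q\<close> of \<open>p\<close> at
  \<open>g\<close> inherits its structure from \<open>p\<close>: testing at \<open>- h\<close> gives
  positivity, and testing at the constants 1 and -1 gives the two inequalities for total mass 1. The
  conclusion says that \<open>g\<close> maximises \<open>\<integral> h d\<sigma> - p h\<close> over
  \<open>h\<close>.\<close>

lemma exists_prob_subgradient:
  fixes p :: "('y::metric_space \<Rightarrow>\<^sub>C real) \<Rightarrow> real"
  assumes cpt: "compact (UNIV :: 'y set)"
    and mono: "\<And>f g. (\<And>y. apply_bcontfun f y \<le> apply_bcontfun g y) \<Longrightarrow> p f \<le> p g"
    and trans: "\<And>g k. p (g + const_bcontfun k) = p g + k"
    and convex: "\<And>f g t. 0 \<le> t \<Longrightarrow> t \<le> 1 \<Longrightarrow> p (t *\<^sub>R f + (1 - t) *\<^sub>R g) \<le> t * p f + (1 - t) * p g"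
  obtains \<sigma> where "\<sigma> \<in> borel_probs"
    "\<And>h. (\<integral>y. apply_bcontfun h y \<partial>\<sigma>) - p h \<le> (\<integral>y. apply_bcontfun g y \<partial>\<sigma>) - p g"
proof -
  define q where "q h = p (g + h) - p g" for h
  have "convex_on UNIV q"
  proof (intro convex_onI convex_UNIV)
    fix t :: real and f h :: "'y \<Rightarrow>\<^sub>C real" assume t: "0 < t" "t < 1"
    have "g + ((1 - t) *\<^sub>R f + t *\<^sub>R h) = t *\<^sub>R (g + h) + (1 - t) *\<^sub>R (g + f)"
      by (simp add: algebra_simps)
    then have "p (g + ((1 - t) *\<^sub>R f + t *\<^sub>R h)) \<le> t * p (g + h) + (1 - t) * p (g + f)"
      using convex[of t "g + h" "g + f"] t by simp
    then show "q ((1 - t) *\<^sub>R f + t *\<^sub>R h) \<le> (1 - t) * q f + t * q h"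
      by (simp add: q_def algebra_simps)
  qed
  moreover have "q 0 = 0" by (simp add: q_def)
  ultimately obtain l where l: "linear l" "\<And>h. l h \<le> q h"
    using exists_linear_le_convex[of q] by blast
  have "0 \<le> l h" if "\<And>y. 0 \<le> apply_bcontfun h y" for h
  proof -
    have "p (g + - h) \<le> p g" using that by (intro mono) simp
    then show ?thesis using l(2)[of "- h"] linear_neg[OF l(1), of h] by (simp add: q_def)
  qed
  moreover have "l (const_bcontfun 1) = 1"
  proof -
    have "const_bcontfun (-1) = - (const_bcontfun 1 :: 'y \<Rightarrow>\<^sub>C real)" by (rule bcontfun_eqI) simp
    then have "- l (const_bcontfun 1) \<le> - 1"
      using l(2)[of "const_bcontfun (-1)"] linear_neg[OF l(1), of "const_bcontfun 1"] trans[of g "-1"]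
      by (simp add: q_def)
    then show ?thesis using l(2)[of "const_bcontfun 1"] trans[of g 1] by (simp add: q_def)
  qed
  ultimately obtain \<sigma> where \<sigma>: "\<sigma> \<in> borel_probs" "\<And>h. (\<integral>y. apply_bcontfun h y \<partial>\<sigma>) = l h"
    using riesz_representation[OF cpt l(1)] by blast
  have "l h - p h \<le> l g - p g" for h
    using l(2)[of "h - g"] linear_diff[OF l(1), of h g] by (simp add: q_def)
  then show ?thesis using \<sigma> by (intro that[of \<sigma>]) auto
qed

text \<open>A real level \<open>s\<close> is inserted between \<open>r z - b\<close> and
  \<open>f z\<close>. This writes the set as a union of intersections of two open sets, one for
  \<open>f\<close> and one for \<open>r\<close>, and avoids infinite values in the
  difference.\<close>

lemma openin_diff_lsc_less:
  assumes r: "continuous_map Z euclideanreal r" and f: "lsc_map Z f"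
    and fin: "\<And>z. z \<in> topspace Z \<Longrightarrow> f z \<noteq> - \<infinity>"
  shows "openin Z {z \<in> topspace Z. ereal (r z) - f z < b}"
proof -
  have "\<exists>s. ereal s < f z \<and> ereal (r z) - ereal s < b" if "f z \<noteq> - \<infinity>" "ereal (r z) - f z < b" for z
  proof -
    have "ereal (r z) - b < f z" using that by (cases "f z"; cases b) auto
    then obtain s where s: "ereal (r z) - b < ereal s" "ereal s < f z" using ereal_dense2 by blast
    then have "ereal (r z) - ereal s < b" using that by (cases b) auto
    then show ?thesis using s by blast
  qed
  then have 1: "\<exists>s. ereal s < f z \<and> ereal (r z) - ereal s < b" if "z \<in> topspace Z" "ereal (r z) - f z < b" for z
    using fin that by blast
  have 2: "ereal (r z) - f z < b" if "ereal s < f z" "ereal (r z) - ereal s < b" for s z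
    using that by (cases "f z"; cases b) auto
  define A where "A s = {z \<in> topspace Z. ereal s < f z} \<inter> {z \<in> topspace Z. r z \<in> {u. ereal u - ereal s < b}}" for s
  have "open {u. ereal u - ereal s < b}" for s
    unfolding ereal_minus by (intro open_Collect_less continuous_intros)
  then have "openin Z (A s)" for s
    unfolding A_def using f
    by (intro openin_Int openin_continuous_map_preimage[OF r]) (simp_all add: lsc_map_def)
  moreover have "{z \<in> topspace Z. ereal (r z) - f z < b} = (\<Union>s. A s)"
    using 1 2 by (auto simp: A_def)
  ultimately show ?thesis by auto
qed

lemma openin_less_diff_usc:
  assumes r: "continuous_map Z euclideanreal r" and f: "\<And>a. openin Z {z \<in> topspace Z. f z < a}"
  shows "openin Z {z \<in> topspace Z. b < ereal (r z) - f z}"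
proof -
  have "\<exists>s. f z < ereal s \<and> b < ereal (r z) - ereal s" if "b < ereal (r z) - f z" for z
  proof -
    have "f z < ereal (r z) - b" using that by (cases "f z"; cases b) auto
    then obtain s where s: "f z < ereal s" "ereal s < ereal (r z) - b" using ereal_dense2 by blast
    then have "b < ereal (r z) - ereal s" by (cases b) auto
    then show ?thesis using s by blast
  qed
  then have 1: "\<exists>s. f z < ereal s \<and> b < ereal (r z) - ereal s" if "b < ereal (r z) - f z" for z
    using that by blast
  have 2: "b < ereal (r z) - f z" if "f z < ereal s" "b < ereal (r z) - ereal s" for s z
    using that by (cases "f z"; cases b) auto
  define A where "A s = {z \<in> topspace Z. f z < ereal s} \<inter> {z \<in> topspace Z. r z \<in> {u. b < ereal u - ereal s}}" for s
  have "open {u. b < ereal u - ereal s}" for s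
    unfolding ereal_minus by (intro open_Collect_less continuous_intros)
  then have "openin Z (A s)" for s
    unfolding A_def using f
    by (intro openin_Int openin_continuous_map_preimage[OF r]) simp_all
  moreover have "{z \<in> topspace Z. b < ereal (r z) - f z} = (\<Union>s. A s)"
    using 1 2 by (auto simp: A_def)
  ultimately show ?thesis by auto
qed

lemma lsc_map_SUP:
  assumes "\<And>i. i \<in> I \<Longrightarrow> lsc_map Z (f i)"
  shows "lsc_map Z (\<lambda>z. SUP i\<in>I. f i z)"
  unfolding lsc_map_def
proof
  fix a
  have "{z \<in> topspace Z. a < (SUP i\<in>I. f i z)} = (\<Union>i\<in>I. {z \<in> topspace Z. a < f i z})"
    by (auto simp: less_SUP_iff)
  then show "openin Z {z \<in> topspace Z. a < (SUP i\<in>I. f i z)}"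
    using assms by (auto simp: lsc_map_def)
qed

section \<open>The joint cost dual to a backward Kantorovich operator\<close>

definition kantorovich_cost ::
  "(('y::metric_space \<Rightarrow>\<^sub>C real) \<Rightarrow> 'x::metric_space \<Rightarrow> ereal) \<Rightarrow> 'x measure \<Rightarrow> 'y measure \<Rightarrow> ereal" where
  "kantorovich_cost T \<mu> \<nu> = (SUP g. ereal (\<integral>y. apply_bcontfun g y \<partial>\<nu>) - ereal_integral \<mu> (T g))"

lemma kantorovich_cost_upper:
  "ereal (\<integral>y. apply_bcontfun g y \<partial>\<nu>) - ereal_integral \<mu> (T g) \<le> kantorovich_cost T \<mu> \<nu>"
  unfolding kantorovich_cost_def by (rule SUP_upper) simp

context
  fixes T :: "('y::metric_space \<Rightarrow>\<^sub>C real) \<Rightarrow> 'x::metric_space \<Rightarrow> ereal"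
  assumes cptX: "compact (UNIV :: 'x set)" and cptY: "compact (UNIV :: 'y set)"
    and T_Bb: "\<And>g. T g \<in> Bb" and T: "backward_kantorovich T"
begin

lemma backward_kantorovich_USC: "T g \<in> USC"
  and backward_kantorovich_mono: "(\<And>y. apply_bcontfun g1 y \<le> apply_bcontfun g2 y) \<Longrightarrow> T g1 x \<le> T g2 x"
  and backward_kantorovich_add_const: "T (g + const_bcontfun k) x = T g x + ereal k"
  and backward_kantorovich_convex: "0 \<le> t \<Longrightarrow> t \<le> 1 \<Longrightarrow> T (t *\<^sub>R g1 + (1 - t) *\<^sub>R g2) x \<le> ereal t * T g1 x + ereal (1 - t) * T g2 x"
  using T unfolding backward_kantorovich_def by auto

text \<open>One inequality is Young's, built into the supremum that defines the cost. The other is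
  trivial where the integral is -\<infinity>; elsewhere a subgradient \<sigma> at \<open>g\<close>
  bounds its own cost by \<open>\<integral> g d\<sigma> - p g\<close>.\<close>

lemma legendre_kantorovich_cost:
  assumes \<mu>: "\<mu> \<in> borel_probs"
  shows "legendre_probs (kantorovich_cost T \<mu>) g = ereal_integral \<mu> (T g)"
proof (rule antisym)
  let ?E = "\<lambda>g. ereal_integral \<mu> (T g)"
  have top: "?E g \<noteq> \<infinity>" for g using ereal_integral_less_top[OF \<mu> T_Bb, of g] by auto
  show "legendre_probs (kantorovich_cost T \<mu>) g \<le> ?E g"
    unfolding legendre_probs_def
  proof (rule SUP_least)
    fix \<nu> :: "'y measure"
    show "ereal (\<integral>y. apply_bcontfun g y \<partial>\<nu>) - kantorovich_cost T \<mu> \<nu> \<le> ?E g"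
      using kantorovich_cost_upper[of \<nu> g \<mu> T] top[of g]
      by (cases "?E g"; cases "kantorovich_cost T \<mu> \<nu>") auto
  qed
  show "?E g \<le> legendre_probs (kantorovich_cost T \<mu>) g"
  proof (cases "?E g = - \<infinity>")
    case False
    \<comment> \<open>From \<open>g - norm (g - h) \<le> h\<close>, monotonicity and translation
      invariance, the value at \<open>h\<close> is at least the value at \<open>g\<close> minus
      \<open>norm (g - h)\<close>. Finiteness at \<open>g\<close> thus spreads to every
      \<open>h\<close>, and \<open>p\<close> is real-valued.\<close>
    have bot: "?E h \<noteq> - \<infinity>" for h
    proof -
      have "apply_bcontfun g y + - norm (g - h) \<le> apply_bcontfun h y" for y
        using abs_bcontfun_le_norm[of "g - h" y] by simp
      then have "T g x + ereal (- norm (g - h)) \<le> T h x" for x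
        using backward_kantorovich_mono[of "g + const_bcontfun (- norm (g - h))" h x] unfolding backward_kantorovich_add_const by simp
      moreover have "(\<lambda>x. T g x + ereal (- norm (g - h))) \<in> Bb"
        using T_Bb[of "g + const_bcontfun (- norm (g - h))"] unfolding backward_kantorovich_add_const[abs_def] by simp
      ultimately have "?E g + ereal (- norm (g - h)) \<le> ?E h"
        using ereal_integral_mono[OF \<mu> _ T_Bb, of "\<lambda>x. T g x + ereal (- norm (g - h))" h]
          ereal_integral_add_const[OF \<mu> T_Bb, of g "- norm (g - h)"] by simp
      then show ?thesis using False by (cases "?E g") auto
    qed
    define p where "p h = real_of_ereal (?E h)" for h
    have p: "?E h = ereal (p h)" for h
      using top[of h] bot[of h] by (cases "?E h") (simp_all add: p_def)
    have mono: "p f \<le> p h" if "\<And>y. apply_bcontfun f y \<le> apply_bcontfun h y" for f h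
      using ereal_integral_mono[OF \<mu> T_Bb T_Bb, of f h] backward_kantorovich_mono[of f h] that p by simp
    have trans: "p (f + const_bcontfun k) = p f + k" for f k
    proof -
      have "T (f + const_bcontfun k) = (\<lambda>x. T f x + ereal k)" by (rule ext) (rule backward_kantorovich_add_const)
      then show ?thesis
        using ereal_integral_add_const[OF \<mu> T_Bb, of f k] p[of f] p[of "f + const_bcontfun k"] by simp
    qed
    have conv: "p (t *\<^sub>R f + (1 - t) *\<^sub>R h) \<le> t * p f + (1 - t) * p h" if "0 \<le> t" "t \<le> 1" for f h t
      using ereal_integral_convex[OF \<mu> T_Bb T_Bb T_Bb that backward_kantorovich_convex[OF that]] by (simp add: p)
    obtain \<sigma> where \<sigma>: "\<sigma> \<in> borel_probs"
      "\<And>h. (\<integral>y. apply_bcontfun h y \<partial>\<sigma>) - p h \<le> (\<integral>y. apply_bcontfun g y \<partial>\<sigma>) - p g"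
      using exists_prob_subgradient[OF cptY mono trans conv] by blast
    have "kantorovich_cost T \<mu> \<sigma> \<le> ereal ((\<integral>y. apply_bcontfun g y \<partial>\<sigma>) - p g)"
      unfolding kantorovich_cost_def using \<sigma>(2) by (intro SUP_least) (simp add: p)
    then have "?E g \<le> ereal (\<integral>y. apply_bcontfun g y \<partial>\<sigma>) - kantorovich_cost T \<mu> \<sigma>"
      by (cases "kantorovich_cost T \<mu> \<sigma>") (auto simp: p)
    also have "\<dots> \<le> legendre_probs (kantorovich_cost T \<mu>) g"
      unfolding legendre_probs_def using \<sigma>(1) by (rule SUP_upper)
    finally show ?thesis .
  qed simp
qed

text \<open>If the cost were infinite at the Dirac mass of \<open>x\<close> for every \<nu>, its
  Legendre transform at 0 would be -\<infinity>; but that transform equals \<open>T 0 x\<close>,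
  which is finite for a suitable \<open>x\<close> because \<open>T 0\<close> is in
  \<open>USC\<close>.\<close>

lemma proper_kantorovich_cost:
  "proper_on (borel_probs \<times> borel_probs) (\<lambda>(\<mu>, \<nu>). kantorovich_cost T \<mu> \<nu>)"
proof -
  have "kantorovich_cost T \<mu> \<nu> \<noteq> - \<infinity>" if "\<mu> \<in> borel_probs" for \<mu> \<nu>
    using kantorovich_cost_upper[of \<nu> 0 \<mu> T] ereal_integral_less_top[OF that T_Bb, of 0]
    by (cases "ereal_integral \<mu> (T 0)") auto
  moreover have "\<exists>\<mu>\<in>borel_probs. \<exists>\<nu>\<in>borel_probs. kantorovich_cost T \<mu> \<nu> \<noteq> \<infinity>"
  proof -
    obtain x where x: "T 0 x \<noteq> - \<infinity>" using backward_kantorovich_USC[of 0] by (auto simp: USC_def)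
    have "\<exists>\<nu>\<in>borel_probs. kantorovich_cost T (return borel x) \<nu> \<noteq> \<infinity>"
    proof (rule ccontr)
      assume "\<not> ?thesis"
      then have "legendre_probs (kantorovich_cost T (return borel x)) 0 \<le> - \<infinity>"
        unfolding legendre_probs_def by (intro SUP_least) auto
      then show False
        using x legendre_kantorovich_cost[OF return_in_borel_probs, of x 0]
        by (simp add: ereal_integral_return T_Bb)
    qed
    then show ?thesis using return_in_borel_probs by blast
  qed
  ultimately show ?thesis by (auto simp: proper_on_def)
qed

text \<open>For fixed \<open>g\<close> the expression under the supremum is affine in the pair of
  measures. Integrals equal to -\<infinity> require separate treatment of \<open>t = 0\<close> and
  \<open>t = 1\<close>.\<close>

lemma convex_kantorovich_cost: "jointly_convex_probs (kantorovich_cost T)"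
  unfolding jointly_convex_probs_def
proof (intro ballI)
  fix \<mu>1 \<mu>2 :: "'x measure" and \<nu>1 \<nu>2 :: "'y measure" and t :: real
  assume h: "\<mu>1 \<in> borel_probs" "\<mu>2 \<in> borel_probs" "\<nu>1 \<in> borel_probs" "\<nu>2 \<in> borel_probs" "t \<in> {0..1}"
  then have t: "0 \<le> t" "t \<le> 1" by auto
  show "kantorovich_cost T (mix_measure t \<mu>1 \<mu>2) (mix_measure t \<nu>1 \<nu>2)
    \<le> ereal t * kantorovich_cost T \<mu>1 \<nu>1 + ereal (1 - t) * kantorovich_cost T \<mu>2 \<nu>2"
    unfolding kantorovich_cost_def[of T "mix_measure t \<mu>1 \<mu>2"]
  proof (rule SUP_least)
    fix g :: "'y \<Rightarrow>\<^sub>C real"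
    let ?r1 = "\<integral>y. apply_bcontfun g y \<partial>\<nu>1" and ?r2 = "\<integral>y. apply_bcontfun g y \<partial>\<nu>2"
    let ?e1 = "ereal_integral \<mu>1 (T g)" and ?e2 = "ereal_integral \<mu>2 (T g)"
    have e: "?e1 < \<infinity>" "?e2 < \<infinity>" using h ereal_integral_less_top T_Bb by blast+
    have "ereal (\<integral>y. apply_bcontfun g y \<partial>mix_measure t \<nu>1 \<nu>2) - ereal_integral (mix_measure t \<mu>1 \<mu>2) (T g) =
        ereal (t * ?r1 + (1 - t) * ?r2) - (ereal t * ?e1 + ereal (1 - t) * ?e2)"
      using h t by (simp add: integral_mix_measure ereal_integral_mix_measure T_Bb)
    also have "\<dots> = ereal t * (ereal ?r1 - ?e1) + ereal (1 - t) * (ereal ?r2 - ?e2)"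
      using e t by (cases ?e1; cases ?e2; cases "t = 0"; cases "t = 1") (auto simp: algebra_simps)
    also have "\<dots> \<le> ereal t * kantorovich_cost T \<mu>1 \<nu>1 + ereal (1 - t) * kantorovich_cost T \<mu>2 \<nu>2"
      using t by (intro add_mono ereal_mult_left_mono kantorovich_cost_upper) auto
    finally show "ereal (\<integral>y. apply_bcontfun g y \<partial>mix_measure t \<nu>1 \<nu>2) - ereal_integral (mix_measure t \<mu>1 \<mu>2) (T g)
      \<le> ereal t * kantorovich_cost T \<mu>1 \<nu>1 + ereal (1 - t) * kantorovich_cost T \<mu>2 \<nu>2" .
  qed
qed

lemma lsc_kantorovich_cost:
  "lsc_map (prod_topology weakstar weakstar) (\<lambda>(\<mu>, \<nu>). kantorovich_cost T \<mu> \<nu>)"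
proof -
  let ?Z = "prod_topology (weakstar :: 'x measure topology) (weakstar :: 'y measure topology)"
  have "lsc_map ?Z (\<lambda>z. ereal (\<integral>y. apply_bcontfun g y \<partial>snd z) - ereal_integral (fst z) (T g))" for g
    unfolding lsc_map_def
  proof (intro allI openin_less_diff_usc)
    show "continuous_map ?Z euclideanreal (\<lambda>z. \<integral>y. apply_bcontfun g y \<partial>snd z)"
      using continuous_map_compose[OF continuous_map_snd continuous_map_weakstar_integral[of g]]
      by (simp add: comp_def)
    fix a
    have "usc_map euclidean (T g)" using backward_kantorovich_USC by (simp add: USC_def)
    then have "openin weakstar {\<mu> \<in> borel_probs. ereal_integral \<mu> (T g) < a}"
      by (intro openin_ereal_integral_less cptX T_Bb)
    from openin_continuous_map_preimage[OF continuous_map_fst this, of "weakstar :: 'y measure topology"]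
    show "openin ?Z {z \<in> topspace ?Z. ereal_integral (fst z) (T g) < a}"
      by (rule back_subst[of "openin ?Z"]) auto
  qed
  then show ?thesis
    unfolding kantorovich_cost_def case_prod_beta by (intro lsc_map_SUP)
qed

end

section \<open>Restriction of a joint cost to Dirac masses\<close>

text \<open>The delicate point is properness. If the cost were infinite at all Dirac masses,
  \<open>T 0\<close> would be -\<infinity> everywhere and so would its integral against every \<mu>;
  by \<open>leg\<close> the joint cost would be infinite at every pair. Semi-continuity is inherited
  because Dirac masses depend continuously on their point.\<close>

lemma pointwise_cost_of_joint_cost:
  fixes \<T> :: "'x::metric_space measure \<Rightarrow> 'y::metric_space measure \<Rightarrow> ereal"
  assumes proper: "proper_on (borel_probs \<times> borel_probs) (\<lambda>(\<mu>, \<nu>). \<T> \<mu> \<nu>)"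
    and conv: "jointly_convex_probs \<T>"
    and lsc: "lsc_map (prod_topology weakstar weakstar) (\<lambda>(\<mu>, \<nu>). \<T> \<mu> \<nu>)"
    and T: "\<And>g. T g \<in> Bb"
    and leg: "\<And>\<mu> g. \<mu> \<in> borel_probs \<Longrightarrow> legendre_probs (\<T> \<mu>) g = ereal_integral \<mu> (T g)"
  defines "c \<equiv> \<lambda>x. \<T> (return borel x)"
  shows "proper_on (UNIV \<times> borel_probs) (\<lambda>(x, \<sigma>). c x \<sigma>)"
    and "lsc_map (prod_topology euclidean weakstar) (\<lambda>(x, \<sigma>). c x \<sigma>)"
    and "convex_probs (c x)"
    and "T g x = legendre_probs (c x) g"
proof -
  show Tg: "T g x = legendre_probs (c x) g" for g x
    using leg[OF return_in_borel_probs, of x g] by (simp add: c_def ereal_integral_return[OF T])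
  have "\<exists>x. \<exists>\<sigma>\<in>borel_probs. c x \<sigma> \<noteq> \<infinity>"
  proof (rule ccontr)
    assume "\<not> ?thesis"
    then have "legendre_probs (c x) 0 \<le> - \<infinity>" for x
      unfolding legendre_probs_def by (intro SUP_least) auto
    then have T0: "T 0 x = - \<infinity>" for x using Tg by simp
    obtain \<mu> \<nu> where mn: "\<mu> \<in> borel_probs" "\<nu> \<in> borel_probs" "\<T> \<mu> \<nu> \<noteq> \<infinity>"
      using proper by (auto simp: proper_on_def)
    have "ereal (\<integral>y. apply_bcontfun 0 y \<partial>\<nu>) - \<T> \<mu> \<nu> \<le> legendre_probs (\<T> \<mu>) 0"
      unfolding legendre_probs_def using mn(2) by (rule SUP_upper)
    also have "\<dots> = ereal_integral \<mu> (T 0)" using mn(1) by (rule leg)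
    \<comment> \<open>The positive part of the constant -\<infinity> integrates to 0 and the
      negative part to \<infinity>, since \<mu> has mass 1.\<close>
    also have "\<dots> = - \<infinity>"
      unfolding ereal_integral_def using borel_probsD[OF mn(1)]
      by (simp add: T0 e2ennreal_infty e2ennreal_neg zero_ennreal.rep_eq)
    finally show False using mn(3) by (cases "\<T> \<mu> \<nu>") auto
  qed
  then show "proper_on (UNIV \<times> borel_probs) (\<lambda>(x, \<sigma>). c x \<sigma>)"
    using proper by (auto simp: proper_on_def c_def return_in_borel_probs)
  show "convex_probs (c x)" for x
    unfolding convex_probs_def c_def
  proof (intro ballI)
    fix \<nu>1 \<nu>2 :: "'y measure" and t :: real
    assume h: "\<nu>1 \<in> borel_probs" "\<nu>2 \<in> borel_probs" "t \<in> {0..1}"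
    have "\<T> (mix_measure t (return borel x) (return borel x)) (mix_measure t \<nu>1 \<nu>2)
        \<le> ereal t * \<T> (return borel x) \<nu>1 + ereal (1 - t) * \<T> (return borel x) \<nu>2"
      using conv h return_in_borel_probs[of x] unfolding jointly_convex_probs_def by blast
    then show "\<T> (return borel x) (mix_measure t \<nu>1 \<nu>2)
        \<le> ereal t * \<T> (return borel x) \<nu>1 + ereal (1 - t) * \<T> (return borel x) \<nu>2"
      using mix_measure_same[OF return_in_borel_probs, of t x] h(3) by simp
  qed
  let ?Z = "prod_topology (euclidean :: 'x topology) (weakstar :: 'y measure topology)"
  have cm: "continuous_map ?Z (prod_topology weakstar weakstar) (\<lambda>z. (return borel (fst z), snd z))"
    using continuous_map_compose[OF continuous_map_fst continuous_map_return] continuous_map_snd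
    by (intro continuous_map_pairedI) (auto simp: comp_def)
  show "lsc_map ?Z (\<lambda>(x, \<sigma>). c x \<sigma>)"
    unfolding lsc_map_def
  proof (intro allI)
    fix a
    have "openin (prod_topology weakstar weakstar)
        {z \<in> topspace (prod_topology weakstar weakstar). a < (case z of (\<mu>, \<nu>) \<Rightarrow> \<T> \<mu> \<nu>)}"
      using lsc by (simp add: lsc_map_def)
    from openin_continuous_map_preimage[OF cm this]
    show "openin ?Z {z \<in> topspace ?Z. a < (case z of (x, \<sigma>) \<Rightarrow> c x \<sigma>)}"
      by (rule back_subst[of "openin ?Z"]) (auto simp: c_def return_in_borel_probs)
  qed
qed

section \<open>Operators given by a supremum over probability measures\<close>

context
  fixes T :: "('y::metric_space \<Rightarrow>\<^sub>C real) \<Rightarrow> 'x::metric_space \<Rightarrow> ereal" and c :: "'x \<Rightarrow> 'y measure \<Rightarrow> ereal"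
  assumes cptY: "compact (UNIV :: 'y set)" and Bb: "\<And>g. T g \<in> Bb"
    and proper: "proper_on (UNIV \<times> borel_probs) (\<lambda>(x, \<sigma>). c x \<sigma>)"
    and lsc: "lsc_map (prod_topology euclidean weakstar) (\<lambda>(x, \<sigma>). c x \<sigma>)"
    and T: "\<And>g x. T g x = legendre_probs (c x) g"
begin

lemma cost_neq_MInfty: "\<sigma> \<in> borel_probs \<Longrightarrow> c x \<sigma> \<noteq> - \<infinity>"
  using proper by (auto simp: proper_on_def)

lemma sup_transform_upper: "\<sigma> \<in> borel_probs \<Longrightarrow> ereal (\<integral>y. apply_bcontfun g y \<partial>\<sigma>) - c x \<sigma> \<le> T g x"
  unfolding T legendre_probs_def by (rule SUP_upper)

lemma sup_transform_least:
  assumes "\<And>\<sigma>. \<sigma> \<in> borel_probs \<Longrightarrow> ereal (\<integral>y. apply_bcontfun g y \<partial>\<sigma>) - c x \<sigma> \<le> b"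
  shows "T g x \<le> b"
  unfolding T legendre_probs_def using assms by (rule SUP_least)

text \<open>A tube argument: the pairs at which the expression is at least \<open>b\<close> form a
  closed set, and projection along the compact factor of probability measures is a closed map. The
  complement of the projection is the required neighbourhood.\<close>

lemma usc_sup_transform: "usc_map euclidean (T g)"
  unfolding usc_map_def
proof (intro allI)
  fix a
  let ?Z = "prod_topology (euclidean :: 'x topology) (weakstar :: 'y measure topology)"
  have "\<exists>V. open V \<and> x \<in> V \<and> V \<subseteq> {x. T g x < a}" if "T g x < a" for x
  proof -
    \<comment> \<open>On the neighbourhood all values are strictly below \<open>b\<close>, but their
      supremum only satisfies \<open>\<le> b\<close>; the gap between \<open>b\<close> and
      \<open>a\<close> restores strictness.\<close>
    obtain b where b: "T g x < b" "b < a" using dense[OF \<open>T g x < a\<close>] by blast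
    let ?W = "{z \<in> topspace ?Z. ereal (\<integral>y. apply_bcontfun g y \<partial>snd z) - (case z of (x, \<sigma>) \<Rightarrow> c x \<sigma>) < b}"
    have "continuous_map ?Z euclideanreal (\<lambda>z. \<integral>y. apply_bcontfun g y \<partial>snd z)"
      using continuous_map_compose[OF continuous_map_snd continuous_map_weakstar_integral[of g]]
      by (simp add: comp_def)
    then have "openin ?Z ?W" using lsc cost_neq_MInfty by (intro openin_diff_lsc_less) auto
    then have "closedin ?Z (topspace ?Z - ?W)" by blast
    then have "closedin euclidean (fst ` (topspace ?Z - ?W))"
      using closed_map_fst[OF compact_space_weakstar[OF cptY]] unfolding closed_map_def by blast
    then have "open (- fst ` (topspace ?Z - ?W))" by (simp add: closed_def)
    moreover have "x \<in> - fst ` (topspace ?Z - ?W)"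
      by (auto intro!: le_less_trans[OF sup_transform_upper b(1)])
    moreover have "T g x' < a" if x': "x' \<in> - fst ` (topspace ?Z - ?W)" for x'
    proof -
      have "ereal (\<integral>y. apply_bcontfun g y \<partial>\<sigma>) - c x' \<sigma> < b" if "\<sigma> \<in> borel_probs" for \<sigma>
      proof (rule ccontr)
        assume "\<not> ?thesis"
        then have "(x', \<sigma>) \<in> topspace ?Z - ?W" using that by simp
        then have "x' \<in> fst ` (topspace ?Z - ?W)" by (rule image_eqI[rotated]) simp
        then show False using x' by simp
      qed
      then have "T g x' \<le> b" by (intro sup_transform_least less_imp_le)
      then show ?thesis using b(2) by simp
    qed
    ultimately show ?thesis by blast
  qed
  then have "open {x. T g x < a}" by (subst open_subopen) blast
  then show "openin euclidean {x \<in> topspace euclidean. T g x < a}" by simp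
qed

text \<open>Half of translation invariance; the reverse half is the same inequality for
  \<open>g + k\<close> and the constant \<open>- k\<close>.\<close>

lemma sup_transform_add_const_le: "T (g + const_bcontfun k) x \<le> T g x + ereal k"
proof (rule sup_transform_least)
  fix \<sigma> :: "'y measure" assume \<sigma>: "\<sigma> \<in> borel_probs"
  interpret prob_space \<sigma> using borel_probsD[OF \<sigma>] by simp
  have "(\<integral>y. apply_bcontfun (g + const_bcontfun k) y \<partial>\<sigma>) = (\<integral>y. apply_bcontfun g y \<partial>\<sigma>) + k"
    using integrable_bcontfun[OF \<sigma>] by (simp add: prob_space)
  then show "ereal (\<integral>y. apply_bcontfun (g + const_bcontfun k) y \<partial>\<sigma>) - c x \<sigma> \<le> T g x + ereal k"
    using sup_transform_upper[OF \<sigma>, of g x] cost_neq_MInfty[OF \<sigma>, of x]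
    by (cases "c x \<sigma>"; cases "T g x") auto
qed

text \<open>For fixed \<open>x\<close> and \<sigma> the map from \<open>g\<close> to
  \<open>\<integral> g d\<sigma> - c x \<sigma>\<close> is monotone, affine and continuous, and the
  supremum over \<sigma> preserves the four operator properties.\<close>

lemma backward_kantorovich_sup_transform: "backward_kantorovich T"
  unfolding backward_kantorovich_def
proof (intro conjI allI impI ballI)
  show "T g \<in> USC" for g
  proof -
    \<comment> \<open>One pair of finite cost works for all \<open>g\<close>, because
      \<open>\<integral> g d\<sigma>\<close> is always real.\<close>
    obtain x \<sigma> where x: "\<sigma> \<in> borel_probs" "c x \<sigma> \<noteq> \<infinity>" using proper by (auto simp: proper_on_def)
    then have "T g x \<noteq> - \<infinity>" using sup_transform_upper[OF x(1), of g x] by (cases "c x \<sigma>") auto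
    then show ?thesis using Bb[of g] usc_sup_transform by (auto simp: USC_def Bb_def)
  qed
  show "T g1 x \<le> T g2 x" if "\<forall>y. apply_bcontfun g1 y \<le> apply_bcontfun g2 y" for g1 g2 x
  proof (rule sup_transform_least)
    fix \<sigma> :: "'y measure" assume \<sigma>: "\<sigma> \<in> borel_probs"
    have "(\<integral>y. apply_bcontfun g1 y \<partial>\<sigma>) \<le> (\<integral>y. apply_bcontfun g2 y \<partial>\<sigma>)"
      using that by (intro integral_mono integrable_bcontfun \<sigma>) simp
    then have "ereal (\<integral>y. apply_bcontfun g1 y \<partial>\<sigma>) - c x \<sigma> \<le> ereal (\<integral>y. apply_bcontfun g2 y \<partial>\<sigma>) - c x \<sigma>"
      by (intro ereal_minus_mono) auto
    also have "\<dots> \<le> T g2 x" using \<sigma> by (rule sup_transform_upper)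
    finally show "ereal (\<integral>y. apply_bcontfun g1 y \<partial>\<sigma>) - c x \<sigma> \<le> T g2 x" .
  qed
  show "T (g + const_bcontfun k) x = T g x + ereal k" for g k x
  proof (rule antisym[OF sup_transform_add_const_le])
    have eq: "g + const_bcontfun k + const_bcontfun (- k) = g" by (rule bcontfun_eqI) simp
    have "T g x \<le> T (g + const_bcontfun k) x + ereal (- k)"
      using sup_transform_add_const_le[of "g + const_bcontfun k" "- k" x] unfolding eq .
    then show "T g x + ereal k \<le> T (g + const_bcontfun k) x"
      by (cases "T g x"; cases "T (g + const_bcontfun k) x") auto
  qed
  show "T (t *\<^sub>R g1 + (1 - t) *\<^sub>R g2) x \<le> ereal t * T g1 x + ereal (1 - t) * T g2 x"
    if "t \<in> {0..1}" for g1 g2 t x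
  proof (rule sup_transform_least)
    have t: "0 \<le> t" "t \<le> 1" using that by auto
    fix \<sigma> :: "'y measure" assume \<sigma>: "\<sigma> \<in> borel_probs"
    let ?r1 = "\<integral>y. apply_bcontfun g1 y \<partial>\<sigma>" and ?r2 = "\<integral>y. apply_bcontfun g2 y \<partial>\<sigma>"
    have "(\<integral>y. apply_bcontfun (t *\<^sub>R g1 + (1 - t) *\<^sub>R g2) y \<partial>\<sigma>) = t * ?r1 + (1 - t) * ?r2"
      using integrable_bcontfun[OF \<sigma>] by simp
    then have "ereal (\<integral>y. apply_bcontfun (t *\<^sub>R g1 + (1 - t) *\<^sub>R g2) y \<partial>\<sigma>) - c x \<sigma>
        \<le> ereal t * (ereal ?r1 - c x \<sigma>) + ereal (1 - t) * (ereal ?r2 - c x \<sigma>)"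
      using cost_neq_MInfty[OF \<sigma>, of x] by (cases "c x \<sigma>") (auto simp: algebra_simps)
    also have "\<dots> \<le> ereal t * T g1 x + ereal (1 - t) * T g2 x"
      using t by (intro add_mono ereal_mult_left_mono sup_transform_upper \<sigma>) auto
    finally show "ereal (\<integral>y. apply_bcontfun (t *\<^sub>R g1 + (1 - t) *\<^sub>R g2) y \<partial>\<sigma>) - c x \<sigma>
        \<le> ereal t * T g1 x + ereal (1 - t) * T g2 x" .
  qed
  show "T g x \<le> liminf (\<lambda>n. T (gs n) x)" if lim: "gs \<longlonglongrightarrow> g" for gs g x
  proof (rule sup_transform_least)
    fix \<sigma> :: "'y measure" assume \<sigma>: "\<sigma> \<in> borel_probs"
    interpret prob_space \<sigma> using borel_probsD[OF \<sigma>] by simp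
    have "(\<lambda>n. \<integral>y. apply_bcontfun (gs n) y \<partial>\<sigma>) \<longlonglongrightarrow> (\<integral>y. apply_bcontfun g y \<partial>\<sigma>)"
    proof (rule LIM_zero_cancel, rule Lim_null_comparison)
      show "(\<lambda>n. norm (gs n - g)) \<longlonglongrightarrow> 0" using lim by (simp add: LIM_zero tendsto_norm_zero)
      have "norm ((\<integral>y. apply_bcontfun (gs n) y \<partial>\<sigma>) - (\<integral>y. apply_bcontfun g y \<partial>\<sigma>)) \<le> norm (gs n - g)" for n
      proof -
        have "(\<integral>y. apply_bcontfun (gs n) y \<partial>\<sigma>) - (\<integral>y. apply_bcontfun g y \<partial>\<sigma>) =
            (\<integral>y. apply_bcontfun (gs n - g) y \<partial>\<sigma>)"
          using integrable_bcontfun[OF \<sigma>] by simp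
        also have "norm \<dots> \<le> (\<integral>y. norm (apply_bcontfun (gs n - g) y) \<partial>\<sigma>)"
          by (rule integral_norm_bound)
        also have "\<dots> \<le> norm (gs n - g)"
          using integrable_bcontfun[OF \<sigma>, of "gs n - g"] abs_bcontfun_le_norm[of "gs n - g"]
          by (intro integral_le_const) auto
        finally show ?thesis .
      qed
      then show "\<forall>\<^sub>F n in sequentially. norm ((\<integral>y. apply_bcontfun (gs n) y \<partial>\<sigma>) - (\<integral>y. apply_bcontfun g y \<partial>\<sigma>))
          \<le> norm (gs n - g)" by simp
    qed
    \<comment> \<open>For infinite \<open>c x \<sigma>\<close> the sequence is constantly
      -\<infinity>; otherwise a real constant is subtracted.\<close>
    then have "(\<lambda>n. ereal (\<integral>y. apply_bcontfun (gs n) y \<partial>\<sigma>) - c x \<sigma>) \<longlonglongrightarrow> ereal (\<integral>y. apply_bcontfun g y \<partial>\<sigma>) - c x \<sigma>"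
      using cost_neq_MInfty[OF \<sigma>, of x] by (cases "c x \<sigma>") (auto intro!: tendsto_intros)
    then have "ereal (\<integral>y. apply_bcontfun g y \<partial>\<sigma>) - c x \<sigma> = liminf (\<lambda>n. ereal (\<integral>y. apply_bcontfun (gs n) y \<partial>\<sigma>) - c x \<sigma>)"
      by (intro lim_imp_Liminf[symmetric]) auto
    also have "\<dots> \<le> liminf (\<lambda>n. T (gs n) x)"
      using sup_transform_upper[OF \<sigma>] by (intro Liminf_mono always_eventually) auto
    finally show "ereal (\<integral>y. apply_bcontfun g y \<partial>\<sigma>) - c x \<sigma> \<le> liminf (\<lambda>n. T (gs n) x)" .
  qed
qed

end

theorem theorem0p2:
  fixes T :: "('y::metric_space \<Rightarrow>\<^sub>C real) \<Rightarrow> 'x::metric_space \<Rightarrow> ereal"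
  assumes "compact (UNIV :: 'x set)"
    and "compact (UNIV :: 'y set)"
    and "\<And>g. T g \<in> Bb"
  defines "stmt1 \<equiv> backward_kantorovich T"
    and "stmt2 \<equiv> (\<exists>\<T> :: 'x measure \<Rightarrow> 'y measure \<Rightarrow> ereal.
        proper_on (borel_probs \<times> borel_probs) (\<lambda>(\<mu>, \<nu>). \<T> \<mu> \<nu>)
      \<and> jointly_convex_probs \<T>
      \<and> lsc_map (prod_topology weakstar weakstar) (\<lambda>(\<mu>, \<nu>). \<T> \<mu> \<nu>)
      \<and> (\<forall>\<mu>\<in>borel_probs. \<forall>g. legendre_probs (\<T> \<mu>) g = ereal_integral \<mu> (T g)))"
    and "stmt3 \<equiv> (\<exists>c :: 'x \<Rightarrow> 'y measure \<Rightarrow> ereal.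
        proper_on (UNIV \<times> borel_probs) (\<lambda>(x, \<sigma>). c x \<sigma>)
      \<and> lsc_map (prod_topology euclidean weakstar) (\<lambda>(x, \<sigma>). c x \<sigma>)
      \<and> (\<forall>x. convex_probs (c x))
      \<and> (\<forall>g x. T g x = (SUP \<sigma>\<in>borel_probs. ereal (\<integral>y. apply_bcontfun g y \<partial>\<sigma>) - c x \<sigma>)))"
  shows "(stmt1 \<longleftrightarrow> stmt2) \<and> (stmt2 \<longleftrightarrow> stmt3)"
proof -
  have "stmt2" if stmt1
  proof -
    have T: "backward_kantorovich T" using that by (simp add: stmt1_def)
    show ?thesis
      unfolding stmt2_def
      using proper_kantorovich_cost[OF assms(1-3) T] convex_kantorovich_cost[OF assms(1-3) T]
        lsc_kantorovich_cost[OF assms(1-3) T] legendre_kantorovich_cost[OF assms(1-3) T]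
      by blast
  qed
  moreover have "stmt3" if stmt2
  proof -
    from that obtain \<T> :: "'x measure \<Rightarrow> 'y measure \<Rightarrow> ereal" where \<T>:
      "proper_on (borel_probs \<times> borel_probs) (\<lambda>(\<mu>, \<nu>). \<T> \<mu> \<nu>)
      \<and> jointly_convex_probs \<T>
      \<and> lsc_map (prod_topology weakstar weakstar) (\<lambda>(\<mu>, \<nu>). \<T> \<mu> \<nu>)
      \<and> (\<forall>\<mu>\<in>borel_probs. \<forall>g. legendre_probs (\<T> \<mu>) g = ereal_integral \<mu> (T g))"
      unfolding stmt2_def ..
    note c = pointwise_cost_of_joint_cost[where T=T and \<T>=\<T>, OF conjunct1[OF \<T>]
        conjunct1[OF conjunct2[OF \<T>]] conjunct1[OF conjunct2[OF conjunct2[OF \<T>]]] assms(3)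
        bspec[OF conjunct2[OF conjunct2[OF conjunct2[OF \<T>]]], THEN spec]]
    show ?thesis
      unfolding stmt3_def legendre_probs_def[symmetric]
      using c by (intro exI[of _ "\<lambda>x. \<T> (return borel x)"]) auto
  qed
  moreover have "stmt1" if stmt3
  proof -
    from that obtain c :: "'x \<Rightarrow> 'y measure \<Rightarrow> ereal" where c:
      "proper_on (UNIV \<times> borel_probs) (\<lambda>(x, \<sigma>). c x \<sigma>)
      \<and> lsc_map (prod_topology euclidean weakstar) (\<lambda>(x, \<sigma>). c x \<sigma>)
      \<and> (\<forall>x. convex_probs (c x)) \<and> (\<forall>g x. T g x = legendre_probs (c x) g)"
      unfolding stmt3_def legendre_probs_def[symmetric] ..
    show ?thesis
      unfolding stmt1_def
    proof (rule backward_kantorovich_sup_transform[where c=c, OF assms(2,3)])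
      show "proper_on (UNIV \<times> borel_probs) (\<lambda>(x, \<sigma>). c x \<sigma>)" using c by (rule conjunct1)
      show "lsc_map (prod_topology euclidean weakstar) (\<lambda>(x, \<sigma>). c x \<sigma>)" using c by blast
      show "T g x = legendre_probs (c x) g" for g x using c by blast
    qed
  qed
  ultimately show ?thesis by blast
qed

end
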